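(* Fix a finite abelian group $A$ (of any order). If there exists a $2$-edge-connected (multi)graph that is not $A$-flow-connected, then there exists a simple, $2$-connected, $3$-edge-connected cubic graph $G$ that is not $A$-flow-connected.
   Context: Graphs are finite. A cycle is a connected 2-regular graph (two parallel edges form a cycle of length 2). Fix an arbitrary orientation $D$ of a graph $G$; for a vertex $v$ let $E_D^+(v)$ and $E_D^-(v)$ be the sets of edges directed out of and into $v$. An $A$-flow on $G$ (always nowhere-zero here) is a function $f:E(G)\to A\setminus\{0_A\}$ with $\sum_{e\in E_D^+(v)}f(e)-\sum_{e\in E_D^-(v)}f(e)=0_A$ for every vertex $v$. (Flows given with different orientations are identified by negating the value of every edge whose orientation is reversed, so the choice of $D$ does not matter.) Two $A$-flows $f',f''$ are adjacent if there is a cycle $C$ in $G$ such that $f'(e)=f''(e)$ for all $e\notin E(C)$, and equivalent if they are joined by a finite sequence of $A$-flows in which consecutive flows are adjacent. $G$ is $A$-flow-connected if all its $A$-flows are pairwise equivalent (vacuously true if $G$ has no $A$-flow). *)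

theory Defs
  imports "HOL-Library.FuncSet" "Graph_Theory.Digraph"
begin

section \<open>Finite undirected multigraphs\<close>

text \<open>
  Each edge carries its set of end vertices, which is a singleton exactly if the edge is a loop.
  Parallel edges are distinct edges with the same set of ends.
\<close>

record ('v, 'e) multigraph =
  mverts :: "'v set"
  medges :: "'e set"
  ends :: "'e \<Rightarrow> 'v set"

definition fin_multigraph :: "('v, 'e) multigraph \<Rightarrow> bool" where
  "fin_multigraph G \<longleftrightarrow> finite (mverts G) \<and> finite (medges G) \<and>
     (\<forall>e\<in>medges G. ends G e \<subseteq> mverts G \<and> card (ends G e) \<in> {1, 2})"

definition simple_graph :: "('v, 'e) multigraph \<Rightarrow> bool" where
  "simple_graph G \<longleftrightarrow> (\<forall>e\<in>medges G. card (ends G e) = 2) \<and> inj_on (ends G) (medges G)"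

text \<open>A loop contributes 2 to the degree of its end.\<close>

definition degree :: "('v, 'e) multigraph \<Rightarrow> 'v \<Rightarrow> nat" where
  "degree G v = card {e \<in> medges G. v \<in> ends G e} + card {e \<in> medges G. ends G e = {v}}"

definition regular :: "nat \<Rightarrow> ('v, 'e) multigraph \<Rightarrow> bool" where
  "regular d G \<longleftrightarrow> (\<forall>v\<in>mverts G. degree G v = d)"

abbreviation cubic :: "('v, 'e) multigraph \<Rightarrow> bool" where
  "cubic G \<equiv> regular 3 G"

definition adj_rel :: "('v, 'e) multigraph \<Rightarrow> ('v \<times> 'v) set" where
  "adj_rel G = {(u, v). \<exists>e\<in>medges G. ends G e = {u, v}}"

definition conn :: "('v, 'e) multigraph \<Rightarrow> bool" where
  "conn G \<longleftrightarrow> mverts G \<noteq> {} \<and> (\<forall>u\<in>mverts G. \<forall>v\<in>mverts G. (u, v) \<in> (adj_rel G)\<^sup>*)"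

definition del_verts :: "('v, 'e) multigraph \<Rightarrow> 'v set \<Rightarrow> ('v, 'e) multigraph" where
  "del_verts G X = G\<lparr>mverts := mverts G - X, medges := {e \<in> medges G. ends G e \<inter> X = {}}\<rparr>"

definition del_edges :: "('v, 'e) multigraph \<Rightarrow> 'e set \<Rightarrow> ('v, 'e) multigraph" where
  "del_edges G F = G\<lparr>medges := medges G - F\<rparr>"

definition k_connected :: "nat \<Rightarrow> ('v, 'e) multigraph \<Rightarrow> bool" where
  "k_connected k G \<longleftrightarrow> k < card (mverts G) \<and>
     (\<forall>X. X \<subseteq> mverts G \<and> card X < k \<longrightarrow> conn (del_verts G X))"

text \<open>One-vertex graphs count as \<open>k\<close>-edge-connected for every \<open>k\<close>.\<close>

definition k_edge_connected :: "nat \<Rightarrow> ('v, 'e) multigraph \<Rightarrow> bool" where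
  "k_edge_connected k G \<longleftrightarrow> mverts G \<noteq> {} \<and>
     (\<forall>F. F \<subseteq> medges G \<and> card F < k \<longrightarrow> conn (del_edges G F))"

definition msubgraph :: "('v, 'e) multigraph \<Rightarrow> ('v, 'e) multigraph \<Rightarrow> bool" where
  "msubgraph H G \<longleftrightarrow> fin_multigraph H \<and> mverts H \<subseteq> mverts G \<and> medges H \<subseteq> medges G \<and>
     (\<forall>e\<in>medges H. ends H e = ends G e)"

text \<open>A cycle may have length 1 (a loop) or 2 (two parallel edges).\<close>

definition is_cycle :: "('v, 'e) multigraph \<Rightarrow> bool" where
  "is_cycle C \<longleftrightarrow> fin_multigraph C \<and> conn C \<and> regular 2 C"

section \<open>Nowhere-zero flows\<close>

definition orientation_of :: "('v, 'e) pre_digraph \<Rightarrow> ('v, 'e) multigraph \<Rightarrow> bool" where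
  "orientation_of D G \<longleftrightarrow> verts D = mverts G \<and> arcs D = medges G \<and>
     (\<forall>e\<in>medges G. ends G e = {tail D e, head D e})"

text \<open>
  Flows are extensional functions, so that they are determined by their values on the edges.
  The coefficient group is the whole of the type \<open>'a\<close>.
\<close>

definition nz_flows :: "('v, 'e) pre_digraph \<Rightarrow> ('e \<Rightarrow> 'a::ab_group_add) set" where
  "nz_flows D = {f \<in> arcs D \<rightarrow>\<^sub>E UNIV - {0}.
     \<forall>v\<in>verts D. (\<Sum>e\<in>out_arcs D v. f e) - (\<Sum>e\<in>in_arcs D v. f e) = 0}"

definition adjacent_flows ::
    "('v, 'e) multigraph \<Rightarrow> ('v, 'e) pre_digraph \<Rightarrow> ('e \<Rightarrow> 'a::ab_group_add) \<Rightarrow> ('e \<Rightarrow> 'a) \<Rightarrow> bool" where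
  "adjacent_flows G D f g \<longleftrightarrow> f \<in> nz_flows D \<and> g \<in> nz_flows D \<and>
     (\<exists>C. msubgraph C G \<and> is_cycle C \<and> (\<forall>e\<in>medges G - medges C. f e = g e))"

definition equivalent_flows ::
    "('v, 'e) multigraph \<Rightarrow> ('v, 'e) pre_digraph \<Rightarrow> ('e \<Rightarrow> 'a::ab_group_add) \<Rightarrow> ('e \<Rightarrow> 'a) \<Rightarrow> bool" where
  "equivalent_flows G D = (adjacent_flows G D)\<^sup>*\<^sup>*"

text \<open>
  The coefficient group is passed as a type. All orientations are quantified over; the lemmas
  \<open>ex_orientation\<close> and \<open>flow_connected_iff\<close> below show that any single one can be used instead.
\<close>

definition flow_connected :: "'a::ab_group_add itself \<Rightarrow> ('v, 'e) multigraph \<Rightarrow> bool" where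
  "flow_connected A G \<longleftrightarrow> (\<forall>D. orientation_of D G \<longrightarrow>
     (\<forall>f\<in>nz_flows D. \<forall>g\<in>nz_flows D. equivalent_flows G D f (g :: 'e \<Rightarrow> 'a)))"

lemma ex_orientation:
  assumes "fin_multigraph G"
  shows "\<exists>D. orientation_of D G"
proof -
  have "\<forall>e\<in>medges G. \<exists>p. ends G e = {fst p, snd p}"
  proof
    fix e assume "e \<in> medges G"
    then have "card (ends G e) = 1 \<or> card (ends G e) = 2"
      using assms by (auto simp: fin_multigraph_def)
    then obtain x y where "ends G e = {x, y}"
      by (metis card_1_singletonE card_2_iff insert_absorb2)
    then show "\<exists>p. ends G e = {fst p, snd p}"
      by (intro exI[of _ "(x, y)"]) simp
  qed
  then obtain p where p: "\<forall>e\<in>medges G. ends G e = {fst (p e), snd (p e)}"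
    by metis
  then show ?thesis
    by (intro exI[of _ "\<lparr>verts = mverts G, arcs = medges G, tail = fst \<circ> p, head = snd \<circ> p\<rparr>"])
      (simp add: orientation_of_def)
qed

definition reorient ::
    "('v, 'e) pre_digraph \<Rightarrow> ('v, 'e) pre_digraph \<Rightarrow> ('e \<Rightarrow> 'a::ab_group_add) \<Rightarrow> 'e \<Rightarrow> 'a" where
  "reorient D D' f = (\<lambda>e\<in>arcs D. if tail D e = tail D' e then f e else - f e)"

lemma reorient_flow:
  fixes G :: "('v, 'e) multigraph" and f :: "'e \<Rightarrow> 'a::ab_group_add"
  assumes G: "fin_multigraph G" and D: "orientation_of D G" and D': "orientation_of D' G"
    and f: "f \<in> nz_flows D"
  shows "reorient D D' f \<in> nz_flows D'"
proof -
  define c :: "('v, 'e) pre_digraph \<Rightarrow> ('e \<Rightarrow> 'a) \<Rightarrow> 'v \<Rightarrow> 'e \<Rightarrow> 'a" where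
    "c = (\<lambda>D h v e. (if tail D e = v then h e else 0) - (if head D e = v then h e else 0))"
  have arcs: "arcs D = medges G" "arcs D' = medges G" "finite (medges G)"
    and verts: "verts D = mverts G" "verts D' = mverts G"
    using G D D' by (auto simp: orientation_of_def fin_multigraph_def)
  have net: "(\<Sum>e\<in>out_arcs F v. h e) - (\<Sum>e\<in>in_arcs F v. h e) = (\<Sum>e\<in>medges G. c F h v e)"
    if "arcs F = medges G" for F v h
    using arcs(3) that
    by (simp add: c_def sum_subtractf out_arcs_def in_arcs_def sum.inter_filter[symmetric])
  have "c D' (reorient D D' f) v e = c D f v e" if e: "e \<in> medges G" for v e
  proof -
    have "{tail D e, head D e} = {tail D' e, head D' e}"
      using D D' e by (auto simp: orientation_of_def)
    then show ?thesis
      using e arcs by (auto simp: c_def reorient_def doubleton_eq_iff)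
  qed
  then show ?thesis
    using f arcs verts by (auto simp: nz_flows_def net PiE_iff reorient_def)
qed

lemma reorient_reorient:
  assumes "orientation_of D G" "orientation_of D' G" "f \<in> nz_flows D"
  shows "reorient D' D (reorient D D' f) = f"
  using assms by (auto simp: reorient_def orientation_of_def nz_flows_def fun_eq_iff PiE_iff extensional_def)

lemma reorient_equivalent:
  fixes G :: "('v, 'e) multigraph" and f g :: "'e \<Rightarrow> 'a::ab_group_add"
  assumes "fin_multigraph G" "orientation_of D G" "orientation_of D' G"
    and "equivalent_flows G D f g"
  shows "equivalent_flows G D' (reorient D D' f) (reorient D D' g)"
  using assms(4) unfolding equivalent_flows_def
proof (induction rule: rtranclp_induct)
  case (step g h)
  then have "adjacent_flows G D' (reorient D D' g) (reorient D D' h)"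
    using assms(1-3) reorient_flow[OF assms(1-3)]
    unfolding adjacent_flows_def by (auto simp: reorient_def orientation_of_def)
  with step.IH show ?case by (meson rtranclp.rtrancl_into_rtrancl)
qed simp

lemma flow_connected_iff:
  assumes "fin_multigraph G" "orientation_of D (G :: ('v, 'e) multigraph)"
  shows "flow_connected (A :: 'a::ab_group_add itself) G \<longleftrightarrow>
    (\<forall>f\<in>nz_flows D. \<forall>g\<in>nz_flows D. equivalent_flows G D f (g :: 'e \<Rightarrow> 'a))"
  unfolding flow_connected_def
  by (metis assms reorient_flow reorient_reorient reorient_equivalent)

end

theory Submission
  imports Defs
begin

text \<open>
  If the group has order 3, then \<open>K33\<close> works: at each vertex the three values of a flow agree up to
  the orientation, so a cycle change would have to alter all nine edges or none, and the two flows
  that are constant up to orientation are not equivalent. With fewer than three elements there is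
  at most one flow. So let the group have at least four elements.

  The argument replaces cycles by integer circulations. Two flows are adjacent exactly if one step
  \<open>g = f + s c\<close> leads from one to the other where \<open>s\<close> is supported on a cycle; allowing any integer
  circulation \<open>s\<close> with values \<open>-1\<close>, \<open>0\<close>, \<open>1\<close> gives the same equivalence relation, because such an \<open>s\<close> is a sum
  of directed cycles with disjoint supports (\<open>steps_imp_equivalent\<close>), and conversely an \<open>A\<close>-valued
  circulation supported on a cycle is a multiple of an integer one (\<open>equivalent_imp_steps\<close>). Steps, unlike
  cycles, survive contraction: if \<open>D\<close> arises from \<open>D'\<close> by identifying vertices and
  dropping arcs that thereby become loops, then restricting flows to the surviving arcs preserves
  equivalence (\<open>contraction.step_res\<close>).
  Hence inequivalent flows of \<open>D\<close> stay inequivalent whenever they both extend to \<open>D'\<close>.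

  In one direction this removes loops and 2-edge-cuts: the values of a flow on the two
  edges of such a cut determine each other, so nothing is lost when one of them is contracted
  (\<open>three_edge_connected_witness\<close>). In the other direction it makes the graph cubic. A vertex \<open>v\<close> of
  degree at least 4 is expanded into a ladder with three rungs: two edges \<open>e1\<close>, \<open>e2\<close> at \<open>v\<close> become
  its two rails, each of the first two rungs shifts a freely chosen amount from one rail to the other
  (\<open>add_rung\<close>), and then one rail is joined to a third edge \<open>e3\<close> and split off from \<open>v\<close>
  (\<open>split_off\<close>), which lowers the degree of \<open>v\<close> by one. With four group elements the amounts can be
  chosen so that both given flows extend, unless \<open>e2\<close> and \<open>e3\<close> carry opposite values at \<open>v\<close> and
  \<open>e1\<close> and \<open>e2\<close> do not; among any three edges some order avoids this for two flows at once
  (\<open>arrange_three\<close>). Expansion keeps the graph 3-edge-connected unless \<open>{e1, e2, e3}\<close> is itself an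
  edge cut, and this fails for one of two triples sharing two edges (\<open>not_both_three_cuts\<close>).

  A 3-edge-connected cubic graph on at least three vertices is simple and 2-connected. The graph with two
  vertices and three parallel edges is avoided by inserting one rung at the very beginning.
\<close>

section \<open>Circulations and steps on digraphs\<close>

definition dart :: "('v, 'e) pre_digraph \<Rightarrow> ('e \<Rightarrow> 'b::ab_group_add) \<Rightarrow> 'v \<Rightarrow> 'e \<Rightarrow> 'b" where
  "dart D k v e = (if tail D e = v then k e else 0) - (if head D e = v then k e else 0)"

definition net :: "('v, 'e) pre_digraph \<Rightarrow> ('e \<Rightarrow> 'b::ab_group_add) \<Rightarrow> 'v \<Rightarrow> 'b" where
  "net D k v = (\<Sum>e\<in>arcs D. dart D k v e)"

definition circ :: "('v, 'e) pre_digraph \<Rightarrow> ('e \<Rightarrow> 'b::ab_group_add) \<Rightarrow> bool" where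
  "circ D k \<longleftrightarrow> (\<forall>v\<in>verts D. net D k v = 0)"

definition signed :: "int \<Rightarrow> 'b::ab_group_add \<Rightarrow> 'b" where
  "signed i c = (if i = 1 then c else if i = -1 then - c else 0)"

text \<open>
  A change by a constant along an arbitrary circulation instead of a cycle: this notion commutes
  with contractions.
\<close>

definition flow_step :: "('v, 'e) pre_digraph \<Rightarrow> ('e \<Rightarrow> 'a::ab_group_add) \<Rightarrow> ('e \<Rightarrow> 'a) \<Rightarrow> bool" where
  "flow_step D f g \<longleftrightarrow> f \<in> nz_flows D \<and> g \<in> nz_flows D \<and>
     (\<exists>(s :: 'e \<Rightarrow> int) c. circ D s \<and>
        (\<forall>e\<in>arcs D. s e \<in> {-1, 0, 1} \<and> g e = f e + signed (s e) c))"

lemma sc_simps [simp]: "signed 1 c = c" "signed (-1) c = - c" "signed 0 c = 0"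
  by (simp_all add: signed_def)

lemma nz_flows_iff:
  assumes "fin_digraph D"
  shows "f \<in> nz_flows D \<longleftrightarrow> f \<in> extensional (arcs D) \<and> (\<forall>e\<in>arcs D. f e \<noteq> 0) \<and> circ D f"
proof -
  have "finite (arcs D)"
    using assms by (rule fin_digraph.finite_arcs)
  then have "(\<Sum>e\<in>out_arcs D v. f e) - (\<Sum>e\<in>in_arcs D v. f e) = net D f v" for v
    by (simp add: net_def dart_def sum_subtractf out_arcs_def in_arcs_def sum.inter_filter)
  then show ?thesis
    unfolding nz_flows_def circ_def by (auto simp: PiE_iff simp del: right_minus_eq)
qed

lemma net_add: "net D (\<lambda>e. k e + l e) v = net D k v + net D l v"
  unfolding net_def sum.distrib[symmetric] by (rule sum.cong) (auto simp: dart_def)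

lemma net_diff: "net D (\<lambda>e. k e - l e) v = net D k v - net D l v"
  unfolding net_def sum_subtractf[symmetric] by (rule sum.cong) (auto simp: dart_def)

lemma net_cong: "(\<And>e. e \<in> arcs D \<Longrightarrow> k e = l e) \<Longrightarrow> net D k v = net D l v"
  unfolding net_def by (rule sum.cong) (auto simp: dart_def)

lemma circ_cong: "(\<And>e. e \<in> arcs D \<Longrightarrow> k e = l e) \<Longrightarrow> circ D k \<longleftrightarrow> circ D l"
  by (simp add: circ_def net_cong[of D k l])

lemma circ_restrict [simp]: "circ D (restrict k (arcs D)) \<longleftrightarrow> circ D k"
  by (rule circ_cong) simp

lemma circ_add: "circ D k \<Longrightarrow> circ D l \<Longrightarrow> circ D (\<lambda>e. k e + l e)"
  by (simp add: circ_def net_add)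

lemma circ_diff: "circ D k \<Longrightarrow> circ D l \<Longrightarrow> circ D (\<lambda>e. k e - l e)"
  by (simp add: circ_def net_diff)

lemma sum_net:
  assumes "finite X"
  shows "(\<Sum>v\<in>X. net D k v) =
    (\<Sum>e\<in>arcs D. (if tail D e \<in> X then k e else 0) - (if head D e \<in> X then k e else 0))"
proof -
  have "(\<Sum>v\<in>X. net D k v) = (\<Sum>e\<in>arcs D. \<Sum>v\<in>X. dart D k v e)"
    unfolding net_def by (rule sum.swap)
  also have "\<dots> = (\<Sum>e\<in>arcs D. (if tail D e \<in> X then k e else 0) - (if head D e \<in> X then k e else 0))"
    using assms by (intro sum.cong) (auto simp: dart_def sum_subtractf)
  finally show ?thesis .
qed

lemma sum_net_verts:
  assumes "fin_digraph D"
  shows "(\<Sum>v\<in>verts D. net D k v) = 0"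
proof -
  interpret fin_digraph D by fact
  show ?thesis by (subst sum_net) (auto intro!: sum.neutral)
qed

section \<open>Cuts and edge-connectivity\<close>

definition edge_cut :: "('v, 'e) pre_digraph \<Rightarrow> 'v set \<Rightarrow> 'e set" where
  "edge_cut D X = {e \<in> arcs D. (tail D e \<in> X) \<noteq> (head D e \<in> X)}"

definition edge_conn :: "nat \<Rightarrow> ('v, 'e) pre_digraph \<Rightarrow> bool" where
  "edge_conn k D \<longleftrightarrow> verts D \<noteq> {} \<and>
     (\<forall>X. X \<subseteq> verts D \<and> X \<noteq> {} \<and> X \<noteq> verts D \<longrightarrow> k \<le> card (edge_cut D X))"

lemma edge_connD:
  assumes "edge_conn k D" "X \<subseteq> verts D" "X \<noteq> {}" "X \<noteq> verts D"
  shows "k \<le> card (edge_cut D X)"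
  using assms by (simp add: edge_conn_def)

lemma finite_cut: "fin_digraph D \<Longrightarrow> finite (edge_cut D X)"
  by (simp add: edge_cut_def fin_digraph.finite_arcs)

lemma cut_compl:
  assumes "fin_digraph D"
  shows "edge_cut D (verts D - X) = edge_cut D X"
proof -
  interpret fin_digraph D by fact
  show ?thesis by (auto simp: edge_cut_def)
qed

text \<open>A set and its complement have the same cut, so one vertex may be kept outside.\<close>

lemma edge_conn_iff_avoiding:
  assumes "fin_digraph D" "v \<in> verts D"
  shows "edge_conn k D \<longleftrightarrow> (\<forall>X. X \<subseteq> verts D - {v} \<and> X \<noteq> {} \<longrightarrow> k \<le> card (edge_cut D X))"
    (is "_ \<longleftrightarrow> ?R")
proof
  assume ?R
  show "edge_conn k D"
    unfolding edge_conn_def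
  proof (intro conjI allI impI)
    fix X assume X: "X \<subseteq> verts D \<and> X \<noteq> {} \<and> X \<noteq> verts D"
    show "k \<le> card (edge_cut D X)"
    proof (cases "v \<in> X")
      case True
      then have "verts D - X \<subseteq> verts D - {v}" "verts D - X \<noteq> {}"
        using X by auto
      then show ?thesis
        using \<open>?R\<close> cut_compl[OF assms(1)] by metis
    qed (use X \<open>?R\<close> in auto)
  qed (use assms in auto)
qed (use assms in \<open>auto simp: edge_conn_def\<close>)

lemma sum_net_cut:
  assumes "fin_digraph D" "X \<subseteq> verts D"
  shows "(\<Sum>v\<in>X. net D k v) = (\<Sum>e\<in>edge_cut D X. if tail D e \<in> X then k e else - k e)"
proof -
  interpret fin_digraph D by fact
  have "finite X"
    using assms(2) finite_verts finite_subset by blast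
  then have "(\<Sum>v\<in>X. net D k v) =
      (\<Sum>e\<in>arcs D. (if tail D e \<in> X then k e else 0) - (if head D e \<in> X then k e else 0))"
    by (rule sum_net)
  also have "\<dots> = (\<Sum>e\<in>edge_cut D X. if tail D e \<in> X then k e else - k e)"
    by (rule sum.mono_neutral_cong_right) (auto simp: edge_cut_def)
  finally show ?thesis .
qed

lemma circ_cut:
  assumes "fin_digraph D" "circ D k" "X \<subseteq> verts D"
  shows "(\<Sum>e\<in>edge_cut D X. if tail D e \<in> X then k e else - k e) = 0"
  unfolding sum_net_cut[OF assms(1,3), symmetric]
  using assms(2,3) by (auto simp: circ_def subset_iff)

section \<open>Passing between multigraphs and digraphs\<close>

definition underlying :: "('v, 'e) pre_digraph \<Rightarrow> ('v, 'e) multigraph" where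
  "underlying D = \<lparr>mverts = verts D, medges = arcs D, ends = (\<lambda>e. {tail D e, head D e})\<rparr>"

lemma underlying_simps [simp]:
  "mverts (underlying D) = verts D" "medges (underlying D) = arcs D" "ends (underlying D) e = {tail D e, head D e}"
  by (simp_all add: underlying_def)

lemma orientation_underlying: "orientation_of D (underlying D)"
  by (simp add: orientation_of_def)

lemma fin_underlying:
  assumes "fin_digraph D"
  shows "fin_multigraph (underlying D)"
proof -
  interpret fin_digraph D by fact
  show ?thesis by (auto simp: fin_multigraph_def card_insert_if)
qed

lemma orientation_fin_digraph:
  assumes "fin_multigraph G" "orientation_of D G"
  shows "fin_digraph D"
  using assms by unfold_locales (auto simp: fin_multigraph_def orientation_of_def)

lemma conn_iff:
  assumes "\<forall>e\<in>medges G. ends G e \<subseteq> mverts G \<and> card (ends G e) \<in> {1, 2}"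
  shows "conn G \<longleftrightarrow> mverts G \<noteq> {} \<and>
    (\<forall>X. X \<subseteq> mverts G \<and> X \<noteq> {} \<and> X \<noteq> mverts G \<longrightarrow>
       (\<exists>e\<in>medges G. ends G e \<inter> X \<noteq> {} \<and> ends G e - X \<noteq> {}))"
    (is "_ \<longleftrightarrow> _ \<and> ?R")
proof (intro iffI conjI)
  assume c: "conn G"
  show ?R
  proof (intro allI impI, rule ccontr)
    fix X assume X: "X \<subseteq> mverts G \<and> X \<noteq> {} \<and> X \<noteq> mverts G"
      and no: "\<not> (\<exists>e\<in>medges G. ends G e \<inter> X \<noteq> {} \<and> ends G e - X \<noteq> {})"
    then obtain u w where uw: "u \<in> X" "w \<in> mverts G - X" by blast
    then have "(u, w) \<in> (adj_rel G)\<^sup>*"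
      using c X by (auto simp: conn_def)
    then have "w \<in> X"
    proof (induction rule: rtrancl_induct)
      case (step y z)
      then obtain e where "e \<in> medges G" "ends G e = {y, z}"
        by (auto simp: adj_rel_def)
      then show ?case using no step.IH by auto
    qed (use uw in auto)
    then show False using uw by blast
  qed
next
  assume *: "mverts G \<noteq> {} \<and> ?R"
  show "conn G"
    unfolding conn_def
  proof (intro conjI ballI)
    fix u v assume uv: "u \<in> mverts G" "v \<in> mverts G"
    define X where "X = {w \<in> mverts G. (u, w) \<in> (adj_rel G)\<^sup>*}"
    have "u \<in> X" "X \<subseteq> mverts G"
      using uv by (auto simp: X_def)
    have "X = mverts G"
    proof (rule ccontr)
      assume "X \<noteq> mverts G"
      then obtain e where e: "e \<in> medges G" "ends G e \<inter> X \<noteq> {}" "ends G e - X \<noteq> {}"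
        using * \<open>u \<in> X\<close> \<open>X \<subseteq> mverts G\<close> by (metis empty_iff)
      then obtain x y where xy: "x \<in> ends G e" "x \<in> X" "y \<in> ends G e" "y \<notin> X" by blast
      have "card (ends G e) = 2"
        using e(1) xy assms by (metis card_1_singletonE insertE singletonD)
      then have "ends G e = {x, y}"
        using xy by (auto simp: card_2_iff)
      then have "(x, y) \<in> adj_rel G"
        using e(1) by (auto simp: adj_rel_def)
      then have "y \<in> X"
        using xy assms e(1) by (auto simp: X_def intro: rtrancl_into_rtrancl)
      then show False using xy by blast
    qed
    then show "(u, v) \<in> (adj_rel G)\<^sup>*"
      using uv by (auto simp: X_def)
  qed (use * in blast)
qed (auto simp: conn_def)

lemma k_edge_connected_iff:
  assumes "fin_multigraph G" "orientation_of D G"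
  shows "k_edge_connected k G \<longleftrightarrow> mverts G \<noteq> {} \<and> (0 < k \<longrightarrow> edge_conn k D)"
proof -
  have G: "mverts G = verts D" "medges G = arcs D"
    "\<And>e. e \<in> arcs D \<Longrightarrow> ends G e = {tail D e, head D e}"
    using assms(2) by (auto simp: orientation_of_def)
  interpret fin_digraph D
    by (rule orientation_fin_digraph) fact+
  have conn: "conn (del_edges G F) \<longleftrightarrow> verts D \<noteq> {} \<and>
      (\<forall>X. X \<subseteq> verts D \<and> X \<noteq> {} \<and> X \<noteq> verts D \<longrightarrow> \<not> edge_cut D X \<subseteq> F)" for F
  proof -
    have "\<forall>e\<in>medges (del_edges G F). ends (del_edges G F) e \<subseteq> mverts (del_edges G F) \<and>
        card (ends (del_edges G F) e) \<in> {1, 2}"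
      using assms(1) by (auto simp: fin_multigraph_def del_edges_def)
    moreover have "(\<exists>e\<in>arcs D - F. ends G e \<inter> X \<noteq> {} \<and> ends G e - X \<noteq> {}) \<longleftrightarrow> \<not> edge_cut D X \<subseteq> F" for X
    proof -
      have "e \<in> edge_cut D X \<longleftrightarrow> ends G e \<inter> X \<noteq> {} \<and> ends G e - X \<noteq> {}" if "e \<in> arcs D" for e
        using that G(3)[OF that] by (auto simp: edge_cut_def)
      then show ?thesis
        by (auto simp: edge_cut_def)
    qed
    ultimately show ?thesis
      by (subst conn_iff) (auto simp: del_edges_def G)
  qed
  show ?thesis
  proof (intro iffI conjI impI)
    assume k: "k_edge_connected k G" and "0 < k"
    show "edge_conn k D"
      unfolding edge_conn_def
    proof (intro conjI allI impI)
      fix X assume X: "X \<subseteq> verts D \<and> X \<noteq> {} \<and> X \<noteq> verts D"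
      show "k \<le> card (edge_cut D X)"
      proof (rule ccontr)
        assume "\<not> k \<le> card (edge_cut D X)"
        then have "conn (del_edges G (edge_cut D X))"
          using k by (auto simp: k_edge_connected_def G edge_cut_def)
        then show False using X by (auto simp: conn)
      qed
    qed (use k in \<open>auto simp: k_edge_connected_def G\<close>)
  next
    assume *: "mverts G \<noteq> {} \<and> (0 < k \<longrightarrow> edge_conn k D)"
    show "k_edge_connected k G"
      unfolding k_edge_connected_def
    proof (intro conjI allI impI)
      fix F assume F: "F \<subseteq> medges G \<and> card F < k"
      then have "finite F" using G finite_arcs finite_subset by metis
      then show "conn (del_edges G F)"
        unfolding conn
      proof (intro conjI allI impI notI)
        fix X assume X: "X \<subseteq> verts D \<and> X \<noteq> {} \<and> X \<noteq> verts D" and sub: "edge_cut D X \<subseteq> F"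
        have "k \<le> card (edge_cut D X)"
          using * F X by (auto simp: edge_conn_def)
        also have "\<dots> \<le> card F"
          using sub \<open>finite F\<close> by (rule card_mono[rotated])
        finally show False using F by simp
      qed (use * G in auto)
    qed (use * in blast)
  qed (auto simp: k_edge_connected_def)
qed

section \<open>Steps decompose into adjacencies\<close>

text \<open>
  The ends of an arc in the digraph in which the arcs with \<open>s e = -1\<close> have been reversed; there every
  circulation with values in \<open>{-1, 0, 1}\<close> is an Eulerian subdigraph.
\<close>

definition tl_of :: "('v, 'e) pre_digraph \<Rightarrow> ('e \<Rightarrow> int) \<Rightarrow> 'e \<Rightarrow> 'v" where
  "tl_of D s e = (if s e = 1 then tail D e else head D e)"

definition hd_of :: "('v, 'e) pre_digraph \<Rightarrow> ('e \<Rightarrow> int) \<Rightarrow> 'e \<Rightarrow> 'v" where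
  "hd_of D s e = (if s e = 1 then head D e else tail D e)"

lemma dart_sc:
  assumes "s e \<in> {-1, 1}"
  shows "dart D (\<lambda>e. signed (s e) c) v e =
    (if tl_of D s e = v then c else 0) - (if hd_of D s e = v then c else 0)"
  using assms by (auto simp: dart_def tl_of_def hd_of_def)

lemma min_invariant_set:
  assumes "finite W" "W \<noteq> {}" "T ` W \<subseteq> W"
  obtains U where "U \<subseteq> W" "U \<noteq> {}" "T ` U \<subseteq> U"
    "\<And>Y. Y \<subseteq> U \<Longrightarrow> Y \<noteq> {} \<Longrightarrow> T ` Y \<subseteq> Y \<Longrightarrow> Y = U"
proof -
  define F where "F = {Y. Y \<subseteq> W \<and> Y \<noteq> {} \<and> T ` Y \<subseteq> Y}"
  have sub: "F \<subseteq> Pow W"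
    unfolding F_def by blast
  have "W \<in> F"
    unfolding F_def mem_Collect_eq using assms by (intro conjI subset_refl)
  have "finite F"
    by (rule finite_subset[OF sub]) (simp add: assms(1))
  moreover have "F \<noteq> {}"
    using \<open>W \<in> F\<close> by blast
  ultimately have fF: "finite F" "F \<noteq> {}" by this+
  from finite_has_minimal[OF fF] obtain U where U: "U \<in> F" and min: "\<forall>Y\<in>F. Y \<subseteq> U \<longrightarrow> U = Y"
    by (rule bexE)
  show thesis
  proof (rule that[of U])
    fix Y assume "Y \<subseteq> U" "Y \<noteq> {}" "T ` Y \<subseteq> Y"
    then have "Y \<in> F" using U unfolding F_def mem_Collect_eq by (meson subset_trans)
    then show "Y = U" using bspec[OF min, of Y] \<open>Y \<subseteq> U\<close> by (metis)
  qed (use U in \<open>simp_all add: F_def\<close>)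
qed

text \<open>
  Every vertex that a supporting arc leads to is left by another one, since the net value is zero.
  Choosing such an arc at each vertex defines a map \<open>T\<close> on a finite set. On a minimal set closed under
  \<open>T\<close> the map is a bijection, so the chosen arcs form a 2-regular graph, and minimality makes it
  connected.
\<close>

lemma directed_cycle:
  fixes D :: "('v, 'e) pre_digraph" and s :: "'e \<Rightarrow> int"
  assumes "fin_digraph D" "circ D s" "\<forall>e\<in>arcs D. s e \<in> {-1, 0, 1}" "\<exists>e\<in>arcs D. s e \<noteq> 0"
  obtains K where "K \<subseteq> arcs D" "K \<noteq> {}" "\<forall>e\<in>K. s e \<noteq> 0"
    "\<And>c :: 'a::ab_group_add. circ D (\<lambda>e. signed (if e \<in> K then s e else 0) c)"
    "circ D (\<lambda>e. if e \<in> K then s e else 0)"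
    "\<And>G. orientation_of D G \<Longrightarrow> fin_multigraph G \<Longrightarrow>
       \<exists>C. msubgraph C G \<and> is_cycle C \<and> medges C = K"
proof -
  interpret fin_digraph D by fact
  define S where "S = {e \<in> arcs D. s e \<noteq> 0}"
  have S: "finite S" "\<And>e. e \<in> S \<Longrightarrow> s e \<in> {-1, 1}" "S \<subseteq> arcs D"
    using assms(3) by (auto simp: S_def)
  let ?t = "tl_of D s" and ?h = "hd_of D s"
  have th: "?t e \<in> verts D" "?h e \<in> verts D" if "e \<in> S" for e
    using that by (auto simp: S_def tl_of_def hd_of_def)
  have out: "\<exists>e'\<in>S. ?t e' = ?h e" if e: "e \<in> S" for e
  proof (rule ccontr)
    assume no: "\<not> ?thesis"
    have "0 = net D s (?h e)"
      using assms(2) th e by (simp add: circ_def)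
    also have "\<dots> = (\<Sum>x\<in>S. dart D s (?h e) x)"
      unfolding net_def by (rule sum.mono_neutral_right) (auto simp: S_def dart_def)
    also have "\<dots> = (\<Sum>x\<in>S. - (if ?h x = ?h e then 1 else 0))"
    proof (rule sum.cong)
      fix x assume x: "x \<in> S"
      have "dart D s (?h e) x = dart D (\<lambda>e. signed (s e) 1) (?h e) x"
        using S(2)[OF x] by (auto simp: dart_def)
      then show "dart D s (?h e) x = - (if ?h x = ?h e then 1 else 0)"
        using S(2)[OF x] no x dart_sc[of s x D 1 "?h e"] by auto
    qed simp
    also have "\<dots> = - (\<Sum>x\<in>S. (if ?h x = ?h e then 1 else 0))"
      by (rule sum_negf)
    finally have "(\<Sum>x\<in>S. (if ?h x = ?h e then 1 else 0 :: int)) = 0"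
      by simp
    moreover have "(\<Sum>x\<in>{e}. (if ?h x = ?h e then 1 else 0 :: int)) \<le> (\<Sum>x\<in>S. (if ?h x = ?h e then 1 else 0))"
      using S e by (intro sum_mono2) auto
    ultimately show False by simp
  qed
  define W where "W = ?t ` S"
  have "\<forall>v\<in>W. \<exists>e\<in>S. ?t e = v"
    by (auto simp: W_def)
  then obtain n where "\<forall>v\<in>W. n v \<in> S \<and> ?t (n v) = v"
    using bchoice[of W "\<lambda>v e. e \<in> S \<and> ?t e = v"] by blast
  then have n: "n v \<in> S" "?t (n v) = v" if "v \<in> W" for v
    using that by auto
  define T where "T v = ?h (n v)" for v
  have "T ` W \<subseteq> W"
  proof (rule image_subsetI)
    fix v assume "v \<in> W"
    then obtain e' where "e' \<in> S" "?t e' = T v"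
      using out[OF n(1)] unfolding T_def by blast
    then show "T v \<in> W" unfolding W_def by (metis imageI)
  qed
  moreover have "finite W" "W \<noteq> {}"
    using S assms(4) by (auto simp: W_def S_def)
  ultimately obtain U where U: "U \<subseteq> W" "U \<noteq> {}" "T ` U \<subseteq> U"
    and min: "\<And>Y. Y \<subseteq> U \<Longrightarrow> Y \<noteq> {} \<Longrightarrow> T ` Y \<subseteq> Y \<Longrightarrow> Y = U"
    using min_invariant_set by metis
  have fU: "finite U"
    using U \<open>finite W\<close> finite_subset by blast
  have TU: "T ` U = U"
    by (rule min) (use U in auto)
  then have bij: "bij_betw T U U"
    using fU by (simp add: bij_betw_def eq_card_imp_inj_on)
  define K where "K = n ` U"
  have inj_n: "inj_on n U"
    using n U by (metis inj_onI subsetD)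
  have KS: "K \<subseteq> S"
    using n U by (auto simp: K_def)
  have cyc: "circ D (\<lambda>e. signed (if e \<in> K then s e else 0) c)" for c :: "'b::ab_group_add"
    unfolding circ_def
  proof
    fix v assume "v \<in> verts D"
    have "net D (\<lambda>e. signed (if e \<in> K then s e else 0) c) v =
        (\<Sum>e\<in>K. (if ?t e = v then c else 0) - (if ?h e = v then c else 0))"
      unfolding net_def
    proof (rule sum.mono_neutral_cong_right)
      fix e assume e: "e \<in> K"
      then have "dart D (\<lambda>e. signed (if e \<in> K then s e else 0) c) v e = dart D (\<lambda>e. signed (s e) c) v e"
        by (simp add: dart_def)
      then show "dart D (\<lambda>e. signed (if e \<in> K then s e else 0) c) v e =
          (if ?t e = v then c else 0) - (if ?h e = v then c else 0)"
        using dart_sc[of s e D c v] S(2) KS e by auto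
    qed (use KS S in \<open>auto simp: dart_def\<close>)
    also have "\<dots> = (\<Sum>u\<in>U. (if u = v then c else 0)) - (\<Sum>u\<in>U. (if T u = v then c else 0))"
      unfolding K_def sum.reindex[OF inj_n] sum_subtractf
      using n U by (intro arg_cong2[of _ _ _ _ minus] sum.cong) (auto simp: T_def)
    also have "(\<Sum>u\<in>U. (if T u = v then c else 0)) = (\<Sum>u\<in>U. (if u = v then c else 0))"
      by (rule sum.reindex_bij_betw[OF bij])
    finally show "net D (\<lambda>e. signed (if e \<in> K then s e else 0) c) v = 0" by simp
  qed
  have graph: "\<exists>C. msubgraph C G \<and> is_cycle C \<and> medges C = K"
    if G: "orientation_of D G" "fin_multigraph G" for G
  proof (intro exI conjI)
    let ?C = "\<lparr>mverts = U, medges = K, ends = ends G\<rparr>"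
    have ends: "ends G e = {?t e, ?h e}" if "e \<in> S" for e
      using G(1) that by (auto simp: orientation_of_def S_def tl_of_def hd_of_def)
    have endsn: "ends G (n u) = {u, T u}" if "u \<in> U" for u
      using ends n U that by (auto simp: T_def)
    have fC: "fin_multigraph ?C"
      using fU TU endsn by (auto simp: fin_multigraph_def K_def card_insert_if)
    show "msubgraph ?C G"
      using fC U th KS S G by (auto simp: msubgraph_def W_def orientation_of_def)
    have "regular 2 ?C"
      unfolding regular_def
    proof
      fix v assume "v \<in> mverts ?C"
      then have v: "v \<in> U" by simp
      then obtain u where u: "u \<in> U" "T u = v"
        using TU by (metis imageE)
      have eq: "u' = u" if "u' \<in> U" "T u' = v" for u'
        using bij u that by (metis bij_betw_def inj_onD)
      have "{e \<in> K. v \<in> ends G e} = n ` {w \<in> U. v \<in> ends G (n w)}"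
        unfolding K_def by blast
      also have "{w \<in> U. v \<in> ends G (n w)} = {w \<in> U. w = v \<or> T w = v}"
        by (rule Collect_cong, rule conj_cong) (simp_all add: endsn eq_commute)
      also have "{w \<in> U. w = v \<or> T w = v} = {v, u}"
        using v u eq by blast
      finally have 1: "{e \<in> K. v \<in> ends G e} = {n v} \<union> {n u}"
        by auto
      have Tv: "T v = v \<longleftrightarrow> u = v"
        using eq[OF v] u(2) by metis
      have "{e \<in> K. ends G e = {v}} = n ` {w \<in> U. ends G (n w) = {v}}"
        unfolding K_def by blast
      also have "{w \<in> U. ends G (n w) = {v}} = {w \<in> U. w = v \<and> T w = v}"
        by (rule Collect_cong, rule conj_cong) (simp_all add: endsn insert_eq_iff doubleton_eq_iff)
      also have "\<dots> = (if u = v then {v} else {})"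
        using v Tv by auto
      finally have 2: "{e \<in> K. ends G e = {v}} = {n v} \<inter> {n u}"
        using u(1) v inj_onD[OF inj_n, of u v] by auto
      from 1 2
      show "degree ?C v = 2"
        using card_Un_Int[of "{n v}" "{n u}"] by (simp add: degree_def)
    qed
    moreover have "conn ?C"
      unfolding conn_def
    proof (intro conjI ballI)
      fix u v assume "u \<in> mverts ?C" "v \<in> mverts ?C"
      then have uv: "u \<in> U" "v \<in> U" by auto
      have "{w \<in> U. (u, w) \<in> (adj_rel ?C)\<^sup>*} = U"
      proof (rule min)
        show "T ` {w \<in> U. (u, w) \<in> (adj_rel ?C)\<^sup>*} \<subseteq> {w \<in> U. (u, w) \<in> (adj_rel ?C)\<^sup>*}"
        proof (clarify, intro conjI)
          fix w assume w: "w \<in> U" "(u, w) \<in> (adj_rel ?C)\<^sup>*"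
          then have "(w, T w) \<in> adj_rel ?C"
            using endsn by (auto simp: adj_rel_def K_def)
          then show "(u, T w) \<in> (adj_rel ?C)\<^sup>*"
            using w by (meson rtrancl_into_rtrancl)
        qed (use TU in auto)
      qed (use uv in auto)
      then show "(u, v) \<in> (adj_rel ?C)\<^sup>*"
        using uv by blast
    qed (use U in auto)
    ultimately show "is_cycle ?C"
      using fC by (simp add: is_cycle_def)
  qed simp
  have "circ D (\<lambda>e. if e \<in> K then s e else 0)"
  proof -
    have "(\<lambda>e. signed (if e \<in> K then s e else 0) (1 :: int)) = (\<lambda>e. if e \<in> K then s e else 0)"
      using S(2) KS by (fastforce simp: signed_def)
    then show ?thesis
      using cyc[of "1 :: int"] by simp
  qed
  moreover have "K \<noteq> {}" "K \<subseteq> arcs D" "\<forall>e\<in>K. s e \<noteq> 0"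
    using U KS by (auto simp: K_def S_def)
  ultimately show thesis
    using that cyc graph by blast
qed

text \<open>
  Peel off one directed cycle of the support at a time. The intermediate functions are nowhere zero
  because every arc is changed at most once, directly to its final value.
\<close>

lemma step_imp_equivalent:
  assumes G: "fin_multigraph G" "orientation_of D G" and "flow_step D f g"
  shows "equivalent_flows G D f g"
proof -
  interpret fin_digraph D by (rule orientation_fin_digraph[OF G])
  have D: "fin_digraph D" by unfold_locales
  have arcs: "arcs D = medges G" using G by (simp add: orientation_of_def)
  obtain s c where s: "circ D (s :: _ \<Rightarrow> int)" "\<forall>e\<in>arcs D. s e \<in> {-1, 0, 1} \<and> g e = f e + signed (s e) c"
    and fg: "f \<in> nz_flows D" "g \<in> nz_flows D"
    using assms(3) by (auto simp: flow_step_def)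
  show ?thesis
    using s fg(1)
  proof (induction "card {e \<in> arcs D. s e \<noteq> 0}" arbitrary: s f rule: less_induct)
    case less
    note fl = nz_flows_iff[OF D]
    show ?case
    proof (cases "\<exists>e\<in>arcs D. s e \<noteq> 0")
      case False
      then have "f = g"
        using less.prems fg(2) by (intro extensionalityI[of _ "arcs D"]) (auto simp: fl)
      then show ?thesis by (simp add: equivalent_flows_def)
    next
      case True
      obtain K where K: "K \<subseteq> arcs D" "K \<noteq> {}" "\<forall>e\<in>K. s e \<noteq> 0"
        "circ D (\<lambda>e. signed (if e \<in> K then s e else 0) c)" "circ D (\<lambda>e. if e \<in> K then s e else 0)"
        "\<exists>C. msubgraph C G \<and> is_cycle C \<and> medges C = K"
        using directed_cycle[OF D less.prems(1) _ True, of thesis] less.prems(2) G by blast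
      define f1 where "f1 = (\<lambda>e\<in>arcs D. if e \<in> K then g e else f e)"
      define s1 where "s1 e = s e - (if e \<in> K then s e else 0)" for e
      have "circ D f1"
      proof -
        have "circ D (\<lambda>e. f e + signed (if e \<in> K then s e else 0) c)"
          using less.prems K by (intro circ_add) (auto simp: fl)
        then show ?thesis
          using less.prems(2) by (subst circ_cong) (auto simp: f1_def)
      qed
      then have f1: "f1 \<in> nz_flows D"
        using less.prems fg(2) by (auto simp: fl f1_def)
      have "adjacent_flows G D f f1"
        using less.prems(3) f1 K(6) by (auto simp: adjacent_flows_def f1_def arcs)
      moreover have "equivalent_flows G D f1 g"
      proof (rule less.hyps)
        show "card {e \<in> arcs D. s1 e \<noteq> 0} < card {e \<in> arcs D. s e \<noteq> 0}"
          using K by (intro psubset_card_mono) (auto simp: s1_def)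
        show "circ D s1"
          unfolding s1_def using less.prems K by (intro circ_diff)
        show "\<forall>e\<in>arcs D. s1 e \<in> {-1, 0, 1} \<and> g e = f1 e + signed (s1 e) c"
          using less.prems(2) by (auto simp: s1_def f1_def)
      qed (fact f1)
      ultimately show ?thesis
        unfolding equivalent_flows_def by (rule converse_rtranclp_into_rtranclp)
    qed
  qed
qed

lemma steps_imp_equivalent:
  assumes G: "fin_multigraph G" "orientation_of D G" and "(flow_step D)\<^sup>*\<^sup>* f g"
  shows "equivalent_flows G D f g"
  using assms(3)
proof (induction rule: rtranclp_induct)
  case (step g h)
  then show ?case
    using step_imp_equivalent[OF G, of g h] by (auto simp: equivalent_flows_def)
qed (simp add: equivalent_flows_def)

section \<open>Adjacencies are steps\<close>

lemma degree_tail_head: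
  assumes "finite (medges G)" "\<And>e. e \<in> medges G \<Longrightarrow> ends G e = {t e, h e}"
  shows "degree G v = card {e \<in> medges G. t e = v} + card {e \<in> medges G. h e = v}"
proof -
  let ?A = "{e \<in> medges G. t e = v}" and ?B = "{e \<in> medges G. h e = v}"
  have "{e \<in> medges G. v \<in> ends G e} = ?A \<union> ?B"
    "{e \<in> medges G. ends G e = {v}} = ?A \<inter> ?B"
    using assms(2) by auto
  then show ?thesis
    using assms(1) card_Un_Int[of ?A ?B] by (simp add: degree_def)
qed

lemma dart_incident:
  assumes "tail D e \<noteq> head D e" "v \<in> {tail D e, head D e}"
  shows "dart D k v e = (if tail D e = v then k e else - k e)"
  using assms by (cases "tail D e = v") (simp_all add: dart_def)

lemma signed_pair_eq_zero:
  fixes x y :: "'b::ab_group_add"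
  assumes "(if p then x else - x) + (if q then y else - y) = 0"
  shows "y = (if p = q then - x else x)"
  using assms by (cases p; cases q) (simp_all add: add_eq_0_iff)

lemma sum_card_fibres:
  assumes "finite K" "finite U" "t ` K \<subseteq> U"
  shows "(\<Sum>v\<in>U. card {e \<in> K. t e = v}) = card K"
  using sum.group[OF assms, of "\<lambda>_. 1::nat"] by simp

locale cycle_in =
  fixes G C :: "('v, 'e) multigraph" and D :: "('v, 'e) pre_digraph"
  assumes G: "fin_multigraph G" and D: "orientation_of D G"
    and sub: "msubgraph C G" and cyc: "is_cycle C"
begin

sublocale fin_digraph D
  by (rule orientation_fin_digraph[OF G D])

lemma K_arcs: "medges C \<subseteq> arcs D"
  using sub D by (simp add: msubgraph_def orientation_of_def)

lemma fK: "finite (medges C)" and fU: "finite (mverts C)"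
  using sub by (simp_all add: msubgraph_def fin_multigraph_def)

lemma ends_C: "e \<in> medges C \<Longrightarrow> ends C e = {tail D e, head D e}"
  using sub D by (auto simp: msubgraph_def orientation_of_def)

lemma ends_U: "e \<in> medges C \<Longrightarrow> tail D e \<in> mverts C \<and> head D e \<in> mverts C"
  using sub ends_C by (fastforce simp: msubgraph_def fin_multigraph_def)

lemma U_verts: "mverts C \<subseteq> verts D"
  using sub D by (simp add: msubgraph_def orientation_of_def)

lemma degree_C:
  assumes "v \<in> mverts C"
  shows "card {e \<in> medges C. tail D e = v} + card {e \<in> medges C. head D e = v} = 2"
proof -
  have "degree C v = 2"
    using cyc assms by (simp add: is_cycle_def regular_def)
  then show ?thesis
    using degree_tail_head[OF fK ends_C, of v] by simp
qed

lemma card_K: "card (medges C) = card (mverts C)"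
proof -
  have "2 * card (mverts C) =
      (\<Sum>v\<in>mverts C. card {e \<in> medges C. tail D e = v} + card {e \<in> medges C. head D e = v})"
    by (simp add: degree_C)
  also have "\<dots> = 2 * card (medges C)"
    unfolding sum.distrib using ends_U fK fU by (subst (1 2) sum_card_fibres) auto
  finally show ?thesis by simp
qed

lemma propagate:
  assumes nbr: "\<And>v e e'. v \<in> mverts C \<Longrightarrow> e \<in> medges C \<Longrightarrow> e' \<in> medges C \<Longrightarrow> e \<noteq> e' \<Longrightarrow>
      v \<in> {tail D e, head D e} \<Longrightarrow> v \<in> {tail D e', head D e'} \<Longrightarrow> P e \<Longrightarrow> P e'"
    and e0: "e0 \<in> medges C" "P e0" and e: "e \<in> medges C"
  shows "P e"
proof -
  have all: "P e'" if "v \<in> mverts C" "e \<in> medges C" "e' \<in> medges C"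
    "v \<in> {tail D e, head D e}" "v \<in> {tail D e', head D e'}" "P e" for v e e'
    using nbr[of v e e'] that by (cases "e = e'") simp_all
  have "(tail D e0, tail D e) \<in> (adj_rel C)\<^sup>*"
    using cyc ends_U[OF e0(1)] ends_U[OF e] by (simp add: is_cycle_def conn_def)
  then have "tail D e \<in> mverts C \<and> (\<forall>e'\<in>medges C. tail D e \<in> {tail D e', head D e'} \<longrightarrow> P e')"
  proof (induction rule: rtrancl_induct)
    case base
    then show ?case
      using all[of "tail D e0" e0] e0 ends_U[OF e0(1)] by simp
  next
    case (step y z)
    then obtain d where d: "d \<in> medges C" "ends C d = {y, z}"
      by (auto simp: adj_rel_def)
    then have "{tail D d, head D d} = {y, z}"
      using ends_C by simp
    then have inc: "y \<in> {tail D d, head D d}" "z \<in> {tail D d, head D d}"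
      by simp_all
    then have "P d" using step.IH d(1) by blast
    moreover have "z \<in> mverts C" using inc(2) ends_U[OF d(1)] by auto
    ultimately show ?case
      using all[OF _ d(1) _ inc(2)] by blast
  qed
  then show ?thesis using e by simp
qed

lemma net_pair:
  fixes k :: "'e \<Rightarrow> 'b::ab_group_add"
  assumes v: "v \<in> mverts C" and e: "e \<in> medges C" "e' \<in> medges C" "e \<noteq> e'"
    "v \<in> {tail D e, head D e}" "v \<in> {tail D e', head D e'}"
    and off: "\<And>x. x \<in> arcs D \<Longrightarrow> x \<notin> medges C \<Longrightarrow> k x = 0"
  shows "net D k v = (if tail D e = v then k e else - k e) + (if tail D e' = v then k e' else - k e')"
    and "tail D e \<noteq> head D e" "tail D e' \<noteq> head D e'"
proof -
  let ?I = "{x \<in> medges C. v \<in> ends C x}" and ?L = "{x \<in> medges C. ends C x = {v}}"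
  have sub: "{e, e'} \<subseteq> ?I" using e ends_C by auto
  have "card ?I + card ?L = 2"
    using cyc v by (simp add: is_cycle_def regular_def degree_def)
  moreover have "2 \<le> card ?I"
    using card_mono[OF _ sub] fK e(3) by simp
  ultimately have 2: "card ?I = 2" "card ?L = 0" by auto
  have I: "?I = {e, e'}"
    using card_subset_eq[OF _ sub] fK e(3) 2(1) by simp
  have L: "?L = {}" using 2(2) fK by simp
  show nl: "tail D e \<noteq> head D e" "tail D e' \<noteq> head D e'"
    using L e ends_C[OF e(1)] ends_C[OF e(2)] by auto
  have "net D k v = (\<Sum>x\<in>?I. dart D k v x)"
    unfolding net_def
  proof (rule sum.mono_neutral_right)
    show "\<forall>x\<in>arcs D - ?I. dart D k v x = 0"
      using off ends_C by (auto simp: dart_def)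
  qed (use K_arcs in auto)
  also have "\<dots> = dart D k v e + dart D k v e'"
    using I e(3) by simp
  finally show "net D k v =
      (if tail D e = v then k e else - k e) + (if tail D e' = v then k e' else - k e')"
    by (simp only: dart_incident[OF nl(1) e(4)] dart_incident[OF nl(2) e(5)])
qed

text \<open>
  A two-regular connected graph has as many edges as vertices, while the nets of an edge labelling
  modulo 3 are determined by all but one of them. By the pigeonhole principle two labellings have
  the same nets, and their difference is a circulation modulo 3. Representing it by
  \<open>-1\<close>, \<open>0\<close> and \<open>1\<close>, every net has absolute value at most 2 and is divisible by 3.
\<close>

lemma circulation_on_cycle:
  assumes ne: "medges C \<noteq> {}"
  obtains s :: "'e \<Rightarrow> int" where "circ D s" "\<And>e. e \<in> medges C \<Longrightarrow> s e \<in> {-1, 1}"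
    "\<And>e. e \<notin> medges C \<Longrightarrow> s e = 0"
proof -
  let ?K = "medges C" and ?U = "mverts C"
  obtain v0 where v0: "v0 \<in> ?U"
    using ne ends_U by blast
  define F where "F = (?K \<rightarrow>\<^sub>E {0, 1, 2::int})"
  define ex where "ex t e = (if e \<in> ?K then t e else 0)" for t :: "'e \<Rightarrow> int" and e
  define \<Phi> where "\<Phi> t = (\<lambda>v\<in>?U - {v0}. net D (ex t) v mod 3)" for t
  have c3: "card {0, 1, 2::int} = 3" by simp
  have cF: "card F = 3 ^ card ?U"
    unfolding F_def by (simp only: card_PiE[OF fK] c3 prod_constant card_K)
  let ?N = "(?U - {v0}) \<rightarrow>\<^sub>E {0, 1, 2::int}"
  have N: "finite ?N" "card ?N = 3 ^ (card ?U - 1)"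
    using fU v0 by (simp_all add: card_PiE finite_PiE c3 del: card_insert_disjoint)
  have "\<Phi> t \<in> ?N" for t
  proof -
    have "x mod 3 \<in> {0, 1, 2}" for x :: int
      using pos_mod_bound[of 3 x] pos_mod_sign[of 3 x] by auto
    then show ?thesis unfolding \<Phi>_def by auto
  qed
  then have "card (\<Phi> ` F) \<le> 3 ^ (card ?U - 1)"
    unfolding N(2)[symmetric] by (intro card_mono[OF N(1)]) auto
  also have "\<dots> < (3 ^ card ?U :: nat)"
    using card_Diff1_less[OF fU v0] fU v0 by (intro power_strict_increasing) simp_all
  finally have "\<not> inj_on \<Phi> F"
    unfolding cF[symmetric] by (rule pigeonhole)
  then obtain t1 t2 where t: "t1 \<in> F" "t2 \<in> F" "\<Phi> t1 = \<Phi> t2" "t1 \<noteq> t2"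
    by (auto simp: inj_on_def)
  define r where "r e = ex t1 e - ex t2 e" for e
  have r_net: "net D r v = net D (ex t1) v - net D (ex t2) v" for v
    unfolding r_def by (rule net_diff)
  have out: "net D k v = 0" if "v \<notin> ?U" "\<And>e. e \<notin> ?K \<Longrightarrow> k e = 0" for k :: "'e \<Rightarrow> int" and v
    unfolding net_def
  proof (rule sum.neutral, rule ballI)
    fix e assume "e \<in> arcs D"
    show "dart D k v e = 0"
      using that ends_U[of e] by (cases "e \<in> ?K") (auto simp: dart_def)
  qed
  have dvd1: "3 dvd net D r v" if "v \<noteq> v0" for v
  proof (cases "v \<in> ?U")
    case True
    then have "net D (ex t1) v mod 3 = net D (ex t2) v mod 3"
      using fun_cong[OF t(3), of v] that by (simp add: \<Phi>_def)
    then show ?thesis unfolding r_net by (simp add: mod_eq_dvd_iff)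
  next
    case False
    then show ?thesis using out[of v r] by (simp add: r_def ex_def)
  qed
  have dvd: "3 dvd net D r v" for v
  proof (cases "v = v0")
    case True
    have "0 = net D r v0 + (\<Sum>v\<in>verts D - {v0}. net D r v)"
      using sum_net_verts[OF fin_digraph_axioms, of r] v0 U_verts
      by (simp add: sum.remove[of "verts D" v0] subset_iff)
    moreover have "3 dvd (\<Sum>v\<in>verts D - {v0}. net D r v)"
      using dvd1 by (intro dvd_sum) auto
    ultimately show ?thesis unfolding True
      by (metis dvd_0_right dvd_add_left_iff)
  qed (rule dvd1)
  define s where "s e = (r e + 1) mod 3 - 1" for e
  have s_off: "s e = 0" if "e \<notin> ?K" for e
    using that by (simp add: s_def r_def ex_def)
  have s_val: "s e \<in> {-1, 0, 1}" for e
    using pos_mod_bound[of 3 "r e + 1"] pos_mod_sign[of 3 "r e + 1"] by (auto simp: s_def)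
  have s_dvd: "3 dvd net D s v" for v
  proof -
    have s3: "s e - r e = 3 * (- ((r e + 1) div 3))" for e
      using minus_div_mult_eq_mod[of "r e + 1" 3] by (simp add: s_def)
    have sr: "3 dvd s e - r e" for e
      unfolding s3 by (rule dvd_triv_left)
    have "3 dvd net D (\<lambda>e. s e - r e) v"
      unfolding net_def dart_def using sr by (intro dvd_sum dvd_diff) auto
    then show ?thesis
      using dvd[of v] dvd_add[of 3 "net D s v - net D r v" "net D r v"] by (simp add: net_diff)
  qed
  have "net D s v = 0" if v: "v \<in> ?U" for v
  proof -
    have "\<bar>net D s v\<bar> = \<bar>\<Sum>e\<in>?K. dart D s v e\<bar>"
      unfolding net_def using s_off K_arcs
      by (intro arg_cong[of _ _ abs] sum.mono_neutral_right) (auto simp: dart_def)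
    also have "\<dots> \<le> (\<Sum>e\<in>?K. \<bar>dart D s v e\<bar>)"
      by (rule sum_abs)
    also have "\<dots> \<le> (\<Sum>e\<in>?K. (if tail D e = v then 1 else 0) + (if head D e = v then 1 else 0))"
    proof (rule sum_mono)
      fix e
      show "\<bar>dart D s v e\<bar> \<le> (if tail D e = v then 1 else 0) + (if head D e = v then 1 else 0)"
        using s_val[of e] by (auto simp: dart_def)
    qed
    also have "\<dots> = int (card {e \<in> ?K. tail D e = v} + card {e \<in> ?K. head D e = v})"
      using fK by (simp add: sum.distrib sum.inter_filter[symmetric])
    also have "\<dots> = 2"
      using degree_C[OF v] by simp
    finally have "\<bar>net D s v\<bar> \<le> 2" .
    with s_dvd[of v] show ?thesis by presburger
  qed
  then have circ_s: "circ D s"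
    unfolding circ_def using out[of _ s] s_off by blast
  obtain e0 where e0: "e0 \<in> ?K" "t1 e0 \<noteq> t2 e0"
    using t PiE_ext[of t1 ?K "\<lambda>_. {0,1,2}" t2] unfolding F_def by blast
  have "t1 e0 \<in> {0, 1, 2}" "t2 e0 \<in> {0, 1, 2}"
    using t e0 unfolding F_def by (auto dest: PiE_mem)
  then have s0: "s e0 \<noteq> 0"
    using e0 by (auto simp: s_def r_def ex_def)
  have "s e \<noteq> 0" if "e \<in> ?K" for e
  proof (rule propagate[of "\<lambda>e. s e \<noteq> 0", OF _ e0(1) s0 that])
    fix v e e'
    assume *: "v \<in> ?U" "e \<in> ?K" "e' \<in> ?K" "e \<noteq> e'" "v \<in> {tail D e, head D e}"
      "v \<in> {tail D e', head D e'}" "s e \<noteq> 0"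
    have "net D s v = 0"
      using circ_s *(1) U_verts by (auto simp: circ_def)
    then show "s e' \<noteq> 0"
      using net_pair(1)[OF *(1-6), of s] s_off *(7) by (auto split: if_splits)
  qed
  then show thesis
    using that[of s] circ_s s_off s_val by blast
qed

text \<open>
  At a vertex of the cycle the values of \<open>g - f\<close> on the two incident edges determine each other in the
  same way as those of the integer circulation \<open>s\<close>, so their quotient is constant along the cycle.
\<close>

lemma adjacent_step:
  fixes f g :: "'e \<Rightarrow> 'a::ab_group_add"
  assumes f: "f \<in> nz_flows D" and g: "g \<in> nz_flows D"
    and eq: "\<And>e. e \<in> arcs D \<Longrightarrow> e \<notin> medges C \<Longrightarrow> f e = g e"
  shows "flow_step D f g"
proof (cases "medges C = {}")
  case True
  then have "circ D (\<lambda>_. 0 :: int) \<and> (\<forall>e\<in>arcs D. (0::int) \<in> {-1, 0, 1} \<and> g e = f e + signed 0 0)"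
    using eq by (simp add: circ_def net_def dart_def)
  then show ?thesis
    unfolding flow_step_def using f g by blast
next
  case False
  obtain s where s: "circ D (s :: 'e \<Rightarrow> int)" "\<And>e. e \<in> medges C \<Longrightarrow> s e \<in> {-1, 1}"
    "\<And>e. e \<notin> medges C \<Longrightarrow> s e = 0"
    using circulation_on_cycle[OF False] by blast
  obtain e0 where e0: "e0 \<in> medges C"
    using False by blast
  define h where "h e = g e - f e" for e
  have circ_h: "circ D h"
    unfolding h_def using f g nz_flows_iff[OF fin_digraph_axioms] by (intro circ_diff) auto
  have h_off: "\<And>x. x \<in> arcs D \<Longrightarrow> x \<notin> medges C \<Longrightarrow> h x = 0"
    using eq by (simp add: h_def)
  define c where "c = signed (s e0) (h e0)"
  have "h e = signed (s e) c" if e: "e \<in> medges C" for e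
  proof (rule propagate[of "\<lambda>e. h e = signed (s e) c", OF _ e0 _ e])
    show "h e0 = signed (s e0) c"
      using s(2)[OF e0] by (auto simp: c_def)
    fix v e e'
    assume *: "v \<in> mverts C" "e \<in> medges C" "e' \<in> medges C" "e \<noteq> e'" "v \<in> {tail D e, head D e}"
      "v \<in> {tail D e', head D e'}" and h: "h e = signed (s e) c"
    have "net D s v = 0" "net D h v = 0"
      using circ_h s(1) *(1) U_verts by (auto simp: circ_def)
    then have eqs:
      "(if tail D e = v then s e else - s e) + (if tail D e' = v then s e' else - s e') = 0"
      "(if tail D e = v then h e else - h e) + (if tail D e' = v then h e' else - h e') = 0"
      using net_pair(1)[OF *(1-6), of s] net_pair(1)[OF *(1-6), of h] s(3) h_off by simp_all
    have "s e = 1 \<or> s e = -1"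
      using s(2)[OF *(2)] by blast
    then have "signed (- s e) c = - signed (s e) c"
      by (elim disjE) simp_all
    then show "h e' = signed (s e') c"
      unfolding signed_pair_eq_zero[OF eqs(1)] signed_pair_eq_zero[OF eqs(2)] h
      by (simp only: if_distrib[of "\<lambda>i. signed i c"])
  qed
  moreover have "h e = signed (s e) c" if "e \<in> arcs D" "e \<notin> medges C" for e
    using that h_off s(3) by simp
  ultimately have "\<forall>e\<in>arcs D. g e = f e + signed (s e) c"
    unfolding h_def by (metis diff_eq_eq add.commute)
  moreover have "s e \<in> {-1, 0, 1}" for e
    using s(2,3) by (cases "e \<in> medges C") auto
  ultimately show ?thesis
    unfolding flow_step_def using f g s(1) by blast
qed

end

lemma equivalent_imp_steps:
  assumes fin: "fin_multigraph G" and ori: "orientation_of D G" and "equivalent_flows G D f g"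
  shows "(flow_step D)\<^sup>*\<^sup>* f g"
proof -
  have arcs: "arcs D = medges G" using ori by (simp add: orientation_of_def)
  have "flow_step D f' g'" if adj: "adjacent_flows G D f' g'" for f' g'
  proof -
    obtain C where C: "msubgraph C G" "is_cycle C" "\<forall>e\<in>medges G - medges C. f' e = g' e"
      using adj by (auto simp: adjacent_flows_def)
    interpret cycle_in G C D
      by unfold_locales (use C fin ori in auto)
    show ?thesis
      by (intro adjacent_step) (use adj C(3) arcs in \<open>auto simp: adjacent_flows_def\<close>)
  qed
  then have "adjacent_flows G D \<le> flow_step D"
    by (intro predicate2I)
  then show ?thesis
    using assms(3) rtranclp_mono[of "adjacent_flows G D" "flow_step D"]
    unfolding equivalent_flows_def by blast
qed

section \<open>Contractions\<close>

lemma rtranclp_image: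
  assumes "R\<^sup>*\<^sup>* x y" and "\<And>x y. R x y \<Longrightarrow> S (L x) (L y)"
  shows "S\<^sup>*\<^sup>* (L x) (L y)"
  using assms(1)
proof (induction rule: rtranclp_induct)
  case (step y z)
  then show ?case using assms(2) by (meson rtranclp.rtrancl_into_rtrancl)
qed simp

text \<open>
  The map \<open>\<pi>\<close> identifies vertices of \<open>D'\<close>, and the arcs outside the image of \<open>\<iota>\<close> disappear. The fibres
  of \<open>\<pi>\<close> need not be connected. Besides contractions proper this covers the removal of a loop
  (\<open>\<pi>\<close> the identity) and isomorphic copies (\<open>\<iota>\<close> a bijection).
\<close>

locale contraction =
  fixes D' :: "('w, 'd) pre_digraph" and D :: "('v, 'e) pre_digraph"
    and \<pi> :: "'w \<Rightarrow> 'v" and \<iota> :: "'e \<Rightarrow> 'd"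
  assumes fin': "fin_digraph D'" and fin: "fin_digraph D"
    and \<pi>_verts: "u \<in> verts D' \<Longrightarrow> \<pi> u \<in> verts D"
    and inj: "inj_on \<iota> (arcs D)" and \<iota>_arcs: "\<iota> ` arcs D \<subseteq> arcs D'"
    and tail_\<pi>: "e \<in> arcs D \<Longrightarrow> tail D e = \<pi> (tail D' (\<iota> e))"
    and head_\<pi>: "e \<in> arcs D \<Longrightarrow> head D e = \<pi> (head D' (\<iota> e))"
    and collapsed: "d \<in> arcs D' \<Longrightarrow> d \<notin> \<iota> ` arcs D \<Longrightarrow> \<pi> (tail D' d) = \<pi> (head D' d)"
begin

definition res :: "('d \<Rightarrow> 'b::ab_group_add) \<Rightarrow> 'e \<Rightarrow> 'b" where
  "res k = (\<lambda>e\<in>arcs D. k (\<iota> e))"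

lemma net_res: "net D (res k) v = (\<Sum>u | u \<in> verts D' \<and> \<pi> u = v. net D' k u)"
proof -
  interpret D': fin_digraph D' by (rule fin')
  let ?X = "{u. u \<in> verts D' \<and> \<pi> u = v}"
  have "finite ?X" by simp
  then have "(\<Sum>u\<in>?X. net D' k u) =
      (\<Sum>d\<in>arcs D'. (if tail D' d \<in> ?X then k d else 0) - (if head D' d \<in> ?X then k d else 0))"
    by (rule sum_net)
  also have "\<dots> = (\<Sum>d\<in>\<iota> ` arcs D. (if tail D' d \<in> ?X then k d else 0) - (if head D' d \<in> ?X then k d else 0))"
    by (rule sum.mono_neutral_right) (use \<iota>_arcs collapsed in auto)
  also have "\<dots> = (\<Sum>e\<in>arcs D. dart D (res k) v e)"
    unfolding sum.reindex[OF inj]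
  proof (rule sum.cong)
    fix e assume e: "e \<in> arcs D"
    then have "\<iota> e \<in> arcs D'" using \<iota>_arcs by blast
    then show "((\<lambda>d. (if tail D' d \<in> ?X then k d else 0) - (if head D' d \<in> ?X then k d else 0)) \<circ> \<iota>) e =
        dart D (res k) v e"
      using e by (simp add: dart_def res_def tail_\<pi> head_\<pi>)
  qed simp
  finally show ?thesis by (simp add: net_def)
qed

lemma circ_res: "circ D' k \<Longrightarrow> circ D (res k)"
  unfolding circ_def net_res by simp

lemma flow_res: "f \<in> nz_flows D' \<Longrightarrow> res f \<in> nz_flows D"
  using \<iota>_arcs circ_res[of f] unfolding nz_flows_iff[OF fin] nz_flows_iff[OF fin']
  by (auto simp: res_def)

lemma step_res:
  assumes "flow_step D' f g"
  shows "flow_step D (res f) (res g)"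
proof -
  obtain s c where s: "circ D' (s :: 'd \<Rightarrow> int)" "\<forall>e\<in>arcs D'. s e \<in> {-1, 0, 1} \<and> g e = f e + signed (s e) c"
    and fg: "f \<in> nz_flows D'" "g \<in> nz_flows D'"
    using assms by (auto simp: flow_step_def)
  have "\<forall>e\<in>arcs D. res s e \<in> {-1, 0, 1} \<and> res g e = res f e + signed (res s e) c"
    using s(2) \<iota>_arcs by (auto simp: res_def)
  then show ?thesis
    unfolding flow_step_def using circ_res[OF s(1)] flow_res fg by blast
qed

lemma not_steps_if_res: "\<not> (flow_step D)\<^sup>*\<^sup>* (res f) (res g) \<Longrightarrow> \<not> (flow_step D')\<^sup>*\<^sup>* f g"
  using rtranclp_image[of "flow_step D'" f g "flow_step D" res] step_res by blast

lemma cut_preimage: "\<iota> ` edge_cut D X = edge_cut D' {u \<in> verts D'. \<pi> u \<in> X}"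
proof -
  interpret D': fin_digraph D' by (rule fin')
  show ?thesis
  proof (intro set_eqI iffI)
    fix d assume "d \<in> \<iota> ` edge_cut D X"
    then obtain e where e: "d = \<iota> e" "e \<in> arcs D" "(tail D e \<in> X) \<noteq> (head D e \<in> X)"
      by (auto simp: edge_cut_def)
    then have "\<iota> e \<in> arcs D'" using \<iota>_arcs by auto
    then show "d \<in> edge_cut D' {u \<in> verts D'. \<pi> u \<in> X}"
      using e by (simp add: edge_cut_def tail_\<pi> head_\<pi>)
  next
    fix d assume d: "d \<in> edge_cut D' {u \<in> verts D'. \<pi> u \<in> X}"
    then have "d \<in> arcs D'" "(\<pi> (tail D' d) \<in> X) \<noteq> (\<pi> (head D' d) \<in> X)"
      by (auto simp: edge_cut_def)
    then have "d \<in> \<iota> ` arcs D"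
      using collapsed by metis
    then obtain e where e: "e \<in> arcs D" "d = \<iota> e"
      by blast
    then have "e \<in> edge_cut D X"
      using \<open>(\<pi> (tail D' d) \<in> X) \<noteq> (\<pi> (head D' d) \<in> X)\<close>
      by (simp add: edge_cut_def tail_\<pi> head_\<pi>)
    then show "d \<in> \<iota> ` edge_cut D X" using e by blast
  qed
qed

lemma card_cut_preimage: "card (edge_cut D' {u \<in> verts D'. \<pi> u \<in> X}) = card (edge_cut D X)"
  unfolding cut_preimage[symmetric]
  by (rule card_image) (rule inj_on_subset[OF inj], simp add: edge_cut_def)

lemma edge_conn_contract:
  assumes "edge_conn k D'" and surj: "verts D \<subseteq> \<pi> ` verts D'"
  shows "edge_conn k D"
  unfolding edge_conn_def
proof (intro conjI allI impI)
  show "verts D \<noteq> {}"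
    using assms(1) \<pi>_verts by (auto simp: edge_conn_def)
  fix X assume X: "X \<subseteq> verts D \<and> X \<noteq> {} \<and> X \<noteq> verts D"
  let ?Y = "{u \<in> verts D'. \<pi> u \<in> X}"
  obtain a b where "a \<in> X" "a \<in> verts D" "b \<in> verts D" "b \<notin> X"
    using X by blast
  then have "?Y \<noteq> {}" "?Y \<noteq> verts D'" "?Y \<subseteq> verts D'"
    using surj by auto
  then have "k \<le> card (edge_cut D' ?Y)"
    using assms(1) by (simp add: edge_conn_def)
  then show "k \<le> card (edge_cut D X)"
    by (simp only: card_cut_preimage)
qed

end

text \<open>Without loops, the arcs at \<open>v\<close> are exactly the edge cut of \<open>{v}\<close>.\<close>

definition witness :: "('v, 'e) pre_digraph \<Rightarrow> ('e \<Rightarrow> 'a::ab_group_add) \<Rightarrow> ('e \<Rightarrow> 'a) \<Rightarrow> bool" where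
  "witness D f g \<longleftrightarrow> fin_digraph D \<and> (\<forall>e\<in>arcs D. tail D e \<noteq> head D e) \<and> edge_conn 3 D \<and>
     f \<in> nz_flows D \<and> g \<in> nz_flows D \<and> \<not> (flow_step D)\<^sup>*\<^sup>* f g"

subsection \<open>Removing loops\<close>

text \<open>
  The value on the loop is kept while the other values change, and is corrected by a final step along
  the loop itself.
\<close>

lemma remove_loop:
  fixes D :: "('v, 'e) pre_digraph" and f g :: "'e \<Rightarrow> 'a::ab_group_add"
  assumes D: "fin_digraph D" and l: "l \<in> arcs D" "tail D l = head D l"
    and ec: "edge_conn k D"
    and f: "f \<in> nz_flows D" and g: "g \<in> nz_flows D" and ns: "\<not> (flow_step D)\<^sup>*\<^sup>* f g"
  obtains D0 f0 g0 where "fin_digraph (D0 :: ('v, 'e) pre_digraph)" "arcs D0 = arcs D - {l}"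
    "edge_conn k D0" "(f0 :: 'e \<Rightarrow> 'a) \<in> nz_flows D0" "g0 \<in> nz_flows D0" "\<not> (flow_step D0)\<^sup>*\<^sup>* f0 g0"
proof -
  define D0 where "D0 = D\<lparr>arcs := arcs D - {l}\<rparr>"
  interpret fin_digraph D by fact
  have D0: "fin_digraph D0"
    by unfold_locales (auto simp: D0_def)
  interpret contraction D D0 id id
    by unfold_locales (use l D D0 in \<open>auto simp: D0_def\<close>)
  have net0: "net D0 h v = net D h v" for h :: "'e \<Rightarrow> 'c::ab_group_add" and v
  proof -
    have "net D h v = dart D h v l + (\<Sum>e\<in>arcs D - {l}. dart D h v e)"
      unfolding net_def using l(1) by (rule sum.remove[OF finite_arcs])
    also have "dart D h v l = 0" using l(2) by (simp add: dart_def)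
    finally show ?thesis by (simp add: net_def D0_def dart_def)
  qed
  have circ0: "circ D0 h \<longleftrightarrow> circ D h" for h :: "'e \<Rightarrow> 'c::ab_group_add"
    unfolding circ_def net0 by (simp add: D0_def)
  have arcs0: "arcs D0 = arcs D - {l}" by (simp add: D0_def)
  note fl = nz_flows_iff[OF D] nz_flows_iff[OF D0]
  define L where "L h = (\<lambda>e\<in>arcs D. if e = l then f l else h e)" for h :: "'e \<Rightarrow> 'a"
  have L_flow: "L h \<in> nz_flows D" if "h \<in> nz_flows D0" for h
  proof -
    have "circ D (L h) \<longleftrightarrow> circ D0 (L h)"
      by (rule circ0[symmetric])
    also have "\<dots> \<longleftrightarrow> circ D0 h"
      by (rule circ_cong) (simp add: L_def arcs0)
    finally have "circ D (L h) \<longleftrightarrow> circ D0 h" .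
    then show ?thesis
      using that f l(1) unfolding fl by (simp add: L_def arcs0)
  qed
  have L_step: "flow_step D (L h) (L h')" if "flow_step D0 h h'" for h h'
  proof -
    obtain s c where s: "circ D0 (s :: 'e \<Rightarrow> int)" "\<forall>e\<in>arcs D0. s e \<in> {-1, 0, 1} \<and> h' e = h e + signed (s e) c"
      and fg: "h \<in> nz_flows D0" "h' \<in> nz_flows D0"
      using \<open>flow_step D0 h h'\<close> by (auto simp: flow_step_def)
    define s' where "s' e = (if e = l then 0 else s e)" for e
    have "circ D s'"
      using s(1) unfolding circ0[symmetric]
      by (subst circ_cong[of _ _ s]) (simp_all add: s'_def arcs0)
    moreover have "\<forall>e\<in>arcs D. s' e \<in> {-1, 0, 1} \<and> L h' e = L h e + signed (s' e) c"
      using s(2) by (simp add: s'_def L_def arcs0)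
    ultimately show ?thesis
      unfolding flow_step_def using L_flow fg by blast
  qed
  have "flow_step D (L (res g)) g"
  proof -
    define s :: "'e \<Rightarrow> int" where "s e = (if e = l then 1 else 0)" for e
    have "circ D s"
      unfolding circ0[symmetric] by (auto simp: circ_def net_def dart_def s_def arcs0 split: if_splits intro!: sum.neutral)
    moreover have "\<forall>e\<in>arcs D. s e \<in> {-1, 0, 1} \<and> g e = L (res g) e + signed (s e) (g l - f l)"
      by (simp add: s_def L_def res_def arcs0)
    ultimately show ?thesis
      unfolding flow_step_def using L_flow[OF flow_res[OF g]] g by blast
  qed
  moreover have "L (res f) = f"
    using f unfolding fl by (intro extensionalityI[of _ "arcs D"]) (auto simp: L_def res_def arcs0)
  ultimately have "\<not> (flow_step D0)\<^sup>*\<^sup>* (res f) (res g)"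
    using ns rtranclp_image[of "flow_step D0" "res f" "res g" "flow_step D" L] L_step
    by (metis rtranclp.rtrancl_into_rtrancl)
  moreover have "edge_conn k D0"
    by (rule edge_conn_contract[OF ec]) (simp add: D0_def)
  ultimately show thesis
    using that[OF D0 arcs0 _ flow_res[OF f] flow_res[OF g]] by blast
qed

subsection \<open>Contracting an edge of a 2-edge-edge_cut\<close>

text \<open>
  Being balanced across the cut, a circulation of \<open>D\<close> is determined on \<open>e2\<close> by its value on \<open>e1\<close>.
  Conversely this rule extends every circulation of the contraction to \<open>D\<close>, and since it also applies to
  the integer circulations, it lifts steps.
\<close>

lemma contract_two_cut:
  fixes D :: "('v, 'e) pre_digraph" and f g :: "'e \<Rightarrow> 'a::ab_group_add"
  assumes D: "fin_digraph D" and X: "X \<subseteq> verts D" "edge_cut D X = {e1, e2}" "e1 \<noteq> e2"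
    and ec: "edge_conn k D"
    and f: "f \<in> nz_flows D" and g: "g \<in> nz_flows D" and ns: "\<not> (flow_step D)\<^sup>*\<^sup>* f g"
  obtains D0 f0 g0 where "fin_digraph (D0 :: ('v, 'e) pre_digraph)" "arcs D0 = arcs D - {e2}"
    "edge_conn k D0" "(f0 :: 'e \<Rightarrow> 'a) \<in> nz_flows D0" "g0 \<in> nz_flows D0" "\<not> (flow_step D0)\<^sup>*\<^sup>* f0 g0"
proof -
  interpret fin_digraph D by fact
  define x y where "x = tail D e2" and "y = head D e2"
  have e12: "e1 \<in> arcs D" "e2 \<in> arcs D" and xyX: "x \<in> X \<longleftrightarrow> y \<notin> X"
    using X(2) by (auto simp: edge_cut_def x_def y_def)
  have xy: "x \<in> verts D" "y \<in> verts D" "x \<noteq> y"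
    using e12 xyX by (auto simp: x_def y_def)
  define \<pi> where "\<pi> v = (if v = y then x else v)" for v
  define D0 where "D0 = \<lparr>verts = verts D - {y}, arcs = arcs D - {e2}, tail = \<pi> \<circ> tail D, head = \<pi> \<circ> head D\<rparr>"
  have arcs0: "arcs D0 = arcs D - {e2}" and verts0: "verts D0 = verts D - {y}"
    by (simp_all add: D0_def)
  have D0: "fin_digraph D0"
    by unfold_locales (use xy in \<open>auto simp: D0_def \<pi>_def\<close>)
  interpret contraction D D0 \<pi> id
    by unfold_locales (use D D0 xy in \<open>auto simp: D0_def \<pi>_def x_def y_def\<close>)
  note fl = nz_flows_iff[OF D] nz_flows_iff[OF D0]
  define opp where "opp \<longleftrightarrow> (tail D e1 \<in> X) = (tail D e2 \<in> X)"
  have across: "k e2 = (if opp then - k e1 else k e1)" if "circ D k" for k :: "'e \<Rightarrow> 'c::ab_group_add"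
  proof -
    have "(if tail D e1 \<in> X then k e1 else - k e1) + (if tail D e2 \<in> X then k e2 else - k e2) = 0"
      using circ_cut[OF D that X(1)] X(2,3) by simp
    then show ?thesis
      unfolding opp_def by (rule signed_pair_eq_zero)
  qed
  have circ_lift: "circ D (\<lambda>e. if e = e2 then if opp then - k e1 else k e1 else k e)" (is "circ D ?k")
    if "circ D0 k" for k :: "'e \<Rightarrow> 'c::ab_group_add"
  proof -
    have rk: "net D0 (res ?k) v = 0" if "v \<in> verts D0" for v
      using \<open>circ D0 k\<close> that net_cong[of D0 "res ?k" k v] by (simp add: circ_def res_def arcs0)
    have old: "net D ?k v = 0" if v: "v \<in> verts D" "v \<noteq> x" "v \<noteq> y" for v
    proof -
      have "{u. u \<in> verts D \<and> \<pi> u = v} = {v}"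
        using v by (auto simp: \<pi>_def)
      then show ?thesis
        using rk[of v] v unfolding net_res verts0 by simp
    qed
    have "{u. u \<in> verts D \<and> \<pi> u = x} = {x, y}"
      using xy by (auto simp: \<pi>_def)
    then have sum: "net D ?k x + net D ?k y = 0"
      using rk[of x] xy unfolding net_res verts0 by simp
    have "(\<Sum>v\<in>X. net D ?k v) = 0"
      unfolding sum_net_cut[OF D X(1)] X(2) using X(3) by (simp add: opp_def)
    \<comment> \<open>All vertices of \<open>X\<close> other than this end of \<open>e2\<close> are balanced already.\<close>
    moreover define z where "z = (if x \<in> X then x else y)"
    moreover have z: "z \<in> X" "finite X"
      using xyX finite_subset[OF X(1) finite_verts] by (simp_all add: z_def)
    moreover have "net D ?k v = 0" if v: "v \<in> X - {z}" for v
    proof (rule old)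
      show "v \<in> verts D" "v \<noteq> x" "v \<noteq> y"
        using v X(1) xyX by (auto simp: z_def split: if_splits)
    qed
    ultimately have "net D ?k z = 0"
      by (simp add: sum.remove[of X z])
    then have "net D ?k x = 0 \<and> net D ?k y = 0"
      using sum by (auto simp: z_def split: if_splits)
    then show ?thesis
      using old unfolding circ_def by metis
  qed
  define L where "L h = (\<lambda>e\<in>arcs D. if e = e2 then if opp then - h e1 else h e1 else h e)"
    for h :: "'e \<Rightarrow> 'a"
  have L_flow: "L h \<in> nz_flows D" if h: "h \<in> nz_flows D0" for h
    using h circ_lift[of h] e12 X(3) unfolding fl L_def by (simp add: arcs0)
  have L_step: "flow_step D (L h) (L h')" if "flow_step D0 h h'" for h h'
  proof -
    obtain s c where s: "circ D0 (s :: 'e \<Rightarrow> int)" "\<forall>e\<in>arcs D0. s e \<in> {-1, 0, 1} \<and> h' e = h e + signed (s e) c"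
      and fg: "h \<in> nz_flows D0" "h' \<in> nz_flows D0"
      using \<open>flow_step D0 h h'\<close> by (auto simp: flow_step_def)
    let ?s = "\<lambda>e. if e = e2 then if opp then - s e1 else s e1 else s e"
    have e1: "s e1 = -1 \<or> s e1 = 0 \<or> s e1 = 1" "h' e1 = h e1 + signed (s e1) c"
      using s(2) e12 X(3) arcs0 by auto
    have "?s e \<in> {-1, 0, 1} \<and> L h' e = L h e + signed (?s e) c" if e: "e \<in> arcs D" for e
    proof (cases "e = e2")
      case True
      then show ?thesis
        using e1 e12 unfolding L_def by (cases opp) (elim disjE; simp)+
    next
      case False
      then show ?thesis using s(2) e by (simp add: L_def arcs0)
    qed
    then show ?thesis
      unfolding flow_step_def using L_flow fg circ_lift[OF s(1)] by blast
  qed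
  have L_res: "L (res h) = h" if h: "h \<in> nz_flows D" for h
    using h across[of h] e12 X(3) unfolding fl
    by (intro extensionalityI[of _ "arcs D"]) (auto simp: L_def res_def arcs0)
  have "\<not> (flow_step D0)\<^sup>*\<^sup>* (res f) (res g)"
    using ns rtranclp_image[of "flow_step D0" "res f" "res g" "flow_step D" L] L_step L_res[OF f] L_res[OF g]
    by metis
  moreover have "edge_conn k D0"
  proof (rule edge_conn_contract[OF ec], rule subsetI)
    fix v assume v: "v \<in> verts D0"
    then have "\<pi> v = v" by (simp add: \<pi>_def verts0)
    then show "v \<in> \<pi> ` verts D"
      using v by (metis DiffD1 imageI verts0)
  qed
  ultimately show thesis
    using that[OF D0 arcs0 _ flow_res[OF f] flow_res[OF g]] by blast
qed

lemma three_edge_connected_witness: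
  fixes D :: "('v, 'e) pre_digraph" and f g :: "'e \<Rightarrow> 'a::ab_group_add"
  assumes "fin_digraph D" "edge_conn 2 D" "f \<in> nz_flows D" "g \<in> nz_flows D" "\<not> (flow_step D)\<^sup>*\<^sup>* f g"
  shows "\<exists>(D' :: ('v, 'e) pre_digraph) (f' :: 'e \<Rightarrow> 'a) g'. witness D' f' g'"
  using assms
proof (induction "card (arcs D)" arbitrary: D f g rule: less_induct)
  case less
  have fin: "finite (arcs D)" using less.prems(1) by (rule fin_digraph.finite_arcs)
  show ?case
  proof (cases "\<exists>l\<in>arcs D. tail D l = head D l")
    case True
    then obtain l where l: "l \<in> arcs D" "tail D l = head D l" by blast
    then have lt: "card (arcs D - {l}) < card (arcs D)"
      using card_Diff1_less[OF fin] by blast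
    show ?thesis
      by (rule remove_loop[OF less.prems(1) l less.prems(2-5)]) (rule less.hyps; use lt in simp)
  next
    case noloop: False
    show ?thesis
    proof (cases "edge_conn 3 D")
      case True
      then show ?thesis using noloop less.prems unfolding witness_def by blast
    next
      case False
      then obtain X where X: "X \<subseteq> verts D" "X \<noteq> {}" "X \<noteq> verts D" "\<not> 3 \<le> card (edge_cut D X)"
        using less.prems(2) unfolding edge_conn_def by blast
      then have "2 \<le> card (edge_cut D X)"
        using less.prems(2) unfolding edge_conn_def by blast
      then have "card (edge_cut D X) = 2" using X(4) by simp
      then obtain e1 e2 where e: "edge_cut D X = {e1, e2}" "e1 \<noteq> e2"
        by (auto simp: card_2_iff)
      then have "e2 \<in> arcs D" by (auto simp: edge_cut_def)
      then have lt: "card (arcs D - {e2}) < card (arcs D)"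
        by (rule card_Diff1_less[OF fin])
      show ?thesis
        by (rule contract_two_cut[OF less.prems(1) X(1) e less.prems(2-5)])
          (rule less.hyps; use lt in simp)
    qed
  qed
qed

subsection \<open>Copying to the natural numbers\<close>

lemma nat_witness:
  fixes D :: "('v, 'e) pre_digraph" and f g :: "'e \<Rightarrow> 'a::ab_group_add"
  assumes "witness D f g"
  shows "\<exists>(D' :: (nat, nat) pre_digraph) (f' :: nat \<Rightarrow> 'a) g'. witness D' f' g'"
proof -
  have D: "fin_digraph D" and nl: "\<forall>e\<in>arcs D. tail D e \<noteq> head D e" and ec: "edge_conn 3 D"
    and f: "f \<in> nz_flows D" and g: "g \<in> nz_flows D" and ns: "\<not> (flow_step D)\<^sup>*\<^sup>* f g"
    using assms by (auto simp: witness_def)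
  interpret fin_digraph D by fact
  obtain p :: "'v \<Rightarrow> nat" where p: "inj_on p (verts D)"
    using finite_imp_inj_to_nat_seg[OF finite_verts] by blast
  obtain q :: "'e \<Rightarrow> nat" where q: "inj_on q (arcs D)"
    using finite_imp_inj_to_nat_seg[OF finite_arcs] by blast
  define pi qi where "pi = inv_into (verts D) p" and "qi = inv_into (arcs D) q"
  have pi: "pi (p v) = v" if "v \<in> verts D" for v
    using p that by (simp add: pi_def)
  have qi: "qi (q e) = e" if "e \<in> arcs D" for e
    using q that by (simp add: qi_def)
  define D' where "D' = \<lparr>verts = p ` verts D, arcs = q ` arcs D,
    tail = (\<lambda>i. p (tail D (qi i))), head = (\<lambda>i. p (head D (qi i)))\<rparr>"
  have D': "fin_digraph D'"
    by unfold_locales (auto simp: D'_def qi)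
  interpret contraction D' D pi q
    by unfold_locales (use D D' q in \<open>auto simp: D'_def qi pi\<close>)
  have pre: "{u. u \<in> verts D' \<and> pi u = v} = {p v}" if "v \<in> verts D" for v
    using that by (auto simp: D'_def pi)
  define cp where "cp h = (\<lambda>i\<in>arcs D'. h (qi i))" for h :: "'e \<Rightarrow> 'a"
  have res_cp: "res (cp h) = h" if "h \<in> nz_flows D" for h
    using that unfolding nz_flows_iff[OF D] 
    by (intro extensionalityI[of _ "arcs D"]) (auto simp: res_def cp_def D'_def qi)
  have cp_flow: "cp h \<in> nz_flows D'" if h: "h \<in> nz_flows D" for h
  proof -
    have "net D' (cp h) u = 0" if u: "u \<in> verts D'" for u
    proof -
      obtain v where v: "v \<in> verts D" "u = p v" using u by (auto simp: D'_def)
      have "net D' (cp h) (p v) = net D (res (cp h)) v"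
        unfolding net_res pre[OF v(1)] by simp
      then show ?thesis
        using h v unfolding v(2) res_cp[OF h] nz_flows_iff[OF D] by (simp add: circ_def)
    qed
    then show ?thesis
      using h unfolding nz_flows_iff[OF D] nz_flows_iff[OF D']
      by (auto simp: circ_def cp_def D'_def qi)
  qed
  have "edge_conn 3 D'"
    unfolding edge_conn_def
  proof (intro conjI allI impI)
    show "verts D' \<noteq> {}" using ec by (simp add: edge_conn_def D'_def)
    fix Y assume Y: "Y \<subseteq> verts D' \<and> Y \<noteq> {} \<and> Y \<noteq> verts D'"
    define X where "X = {v \<in> verts D. p v \<in> Y}"
    have "Y = p ` X"
      using Y by (auto simp: X_def D'_def)
    then have "X \<subseteq> verts D" "X \<noteq> {}" "X \<noteq> verts D"
      using Y by (auto simp: X_def D'_def)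
    then have "3 \<le> card (edge_cut D X)"
      using ec by (simp add: edge_conn_def)
    moreover have "{u \<in> verts D'. pi u \<in> X} = Y"
      using Y by (auto simp: X_def D'_def pi)
    ultimately show "3 \<le> card (edge_cut D' Y)"
      using card_cut_preimage[of X] by simp
  qed
  moreover have "\<not> (flow_step D')\<^sup>*\<^sup>* (cp f) (cp g)"
    using not_steps_if_res[of "cp f" "cp g"] ns res_cp f g by simp
  moreover have "\<forall>i\<in>arcs D'. tail D' i \<noteq> head D' i"
    using nl p by (auto simp: D'_def qi dest: inj_onD)
  ultimately show ?thesis
    unfolding witness_def using D' cp_flow f g by blast
qed

section \<open>Expanding a vertex\<close>

text \<open>
  The vertex \<open>v\<close> is replaced by \<open>v\<close> together with the new vertices \<open>W\<close>. An old arc \<open>e\<close> at \<open>v\<close> is attached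
  to \<open>m e\<close> instead, and the new arcs \<open>N\<close> join vertices of \<open>insert v W\<close>. Sending all of \<open>W\<close> to \<open>v\<close> is a
  contraction onto the old digraph.
\<close>

locale expansion =
  fixes D :: "('v, 'e) pre_digraph" and v :: 'v and m :: "'e \<Rightarrow> 'v" and W :: "'v set"
    and N :: "'e set" and t h :: "'e \<Rightarrow> 'v"
  assumes fin: "fin_digraph D" and loopless: "e \<in> arcs D \<Longrightarrow> tail D e \<noteq> head D e"
    and v: "v \<in> verts D"
    and W: "finite W" "W \<inter> verts D = {}" and N: "finite N" "N \<inter> arcs D = {}"
    and m: "m e \<in> insert v W"
    and th: "n \<in> N \<Longrightarrow> t n \<in> insert v W" "n \<in> N \<Longrightarrow> h n \<in> insert v W" "n \<in> N \<Longrightarrow> t n \<noteq> h n"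
begin

definition E :: "('v, 'e) pre_digraph" where
  "E = \<lparr>verts = verts D \<union> W, arcs = arcs D \<union> N,
     tail = (\<lambda>e. if e \<in> N then t e else if tail D e = v then m e else tail D e),
     head = (\<lambda>e. if e \<in> N then h e else if head D e = v then m e else head D e)\<rparr>"

lemma verts_E: "verts E = verts D \<union> W" and arcs_E: "arcs E = arcs D \<union> N"
  by (simp_all add: E_def)

lemma ends_new: "n \<in> N \<Longrightarrow> tail E n = t n \<and> head E n = h n"
  by (simp add: E_def)

lemma ends_old:
  assumes "e \<in> arcs D"
  shows "tail E e = (if tail D e = v then m e else tail D e)"
    "head E e = (if head D e = v then m e else head D e)"
  using assms N by (auto simp: E_def)

lemma old_notin_W: "u \<in> verts D \<Longrightarrow> u \<notin> W"
  using W by blast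

lemma fin_E: "fin_digraph E"
proof -
  interpret fin_digraph D by (rule fin)
  show ?thesis
  proof
    fix e assume e: "e \<in> arcs E"
    show "tail E e \<in> verts E"
      using e th(1)[of e] v m[of e] ends_new[of e] ends_old(1)[of e] tail_in_verts[of e]
      by (auto simp: verts_E arcs_E split: if_splits)
    show "head E e \<in> verts E"
      using e th(2)[of e] v m[of e] ends_new[of e] ends_old(2)[of e] head_in_verts[of e]
      by (auto simp: verts_E arcs_E split: if_splits)
  qed (use W N in \<open>simp_all add: verts_E arcs_E\<close>)
qed

lemma loopless_E:
  assumes e: "e \<in> arcs E"
  shows "tail E e \<noteq> head E e"
proof (cases "e \<in> N")
  case True
  then show ?thesis using th(3) ends_new by simp
next
  case False
  interpret fin_digraph D by (rule fin)
  have eD: "e \<in> arcs D" using e False by (simp add: arcs_E)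
  have "m e = v \<or> m e \<notin> verts D"
    using m[of e] W(2) by blast
  then show ?thesis
    unfolding ends_old[OF eD]
    using loopless[OF eD] tail_in_verts[OF eD] head_in_verts[OF eD] by (auto split: if_splits)
qed

sublocale contraction E D "\<lambda>u. if u \<in> W then v else u" id
proof (intro contraction.intro)
  interpret D: fin_digraph D by (rule fin)
  show "fin_digraph E" "fin_digraph D" by (fact fin_E fin)+
  fix u assume "u \<in> verts E"
  then show "(if u \<in> W then v else u) \<in> verts D"
    using v by (auto simp: verts_E)
next
  show "inj_on id (arcs D)" "id ` arcs D \<subseteq> arcs E"
    by (auto simp: arcs_E)
next
  interpret D: fin_digraph D by (rule fin)
  fix e assume e: "e \<in> arcs D"
  have m': "m e \<notin> W \<longrightarrow> v = m e"
    using m[of e] by auto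
  show "tail D e = (if tail E (id e) \<in> W then v else tail E (id e))"
    using m' old_notin_W[OF D.tail_in_verts[OF e]] by (simp add: ends_old[OF e])
  show "head D e = (if head E (id e) \<in> W then v else head E (id e))"
    using m' old_notin_W[OF D.head_in_verts[OF e]] by (simp add: ends_old[OF e])
next
  fix d assume "d \<in> arcs E" "d \<notin> id ` arcs D"
  then have d: "d \<in> N" by (simp add: arcs_E)
  then show "(if tail E d \<in> W then v else tail E d) = (if head E d \<in> W then v else head E d)"
    using th(1,2)[OF d] by (auto simp: ends_new)
qed

lemma net_old_vertex:
  assumes u: "u \<in> verts D" "u \<noteq> v"
  shows "net E k u = net D k u"
  unfolding net_def
proof (rule sum.mono_neutral_cong_right)
  have uW: "u \<notin> insert v W" using u W by blast
  show "finite (arcs E)" by (rule fin_digraph.finite_arcs[OF fin_E])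
  show "\<forall>e\<in>arcs E - arcs D. dart E k u e = 0"
  proof
    fix e assume "e \<in> arcs E - arcs D"
    then have e: "e \<in> N" by (auto simp: arcs_E)
    then have "t e \<noteq> u" "h e \<noteq> u" using th(1,2)[OF e] uW by metis+
    then show "dart E k u e = 0"
      using ends_new[OF e] by (simp add: dart_def)
  qed
  fix e assume e: "e \<in> arcs D"
  have "m e \<noteq> u" using m[of e] uW by metis
  then show "dart E k u e = dart D k u e"
    using u(2) by (simp add: dart_def ends_old[OF e])
qed (simp add: arcs_E)

lemma dart_old_arc:
  assumes "e \<in> arcs D" and x: "x \<in> insert v W"
  shows "dart E k x e = (if m e = x then dart D k v e else 0)"
proof -
  interpret fin_digraph D by (rule fin)
  have "tail D e \<noteq> v \<Longrightarrow> tail D e \<noteq> x" "head D e \<noteq> v \<Longrightarrow> head D e \<noteq> x"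
    using x W(2) tail_in_verts[OF assms(1)] head_in_verts[OF assms(1)] by blast+
  then have "tail E e = x \<longleftrightarrow> tail D e = v \<and> m e = x" "head E e = x \<longleftrightarrow> head D e = v \<and> m e = x"
    unfolding ends_old[OF assms(1)] by (simp_all split: if_split)
  then show ?thesis
    by (simp add: dart_def)
qed

lemma net_new_vertex:
  assumes x: "x \<in> insert v W"
  shows "net E k x = (\<Sum>e\<in>arcs D. if m e = x then dart D k v e else 0) +
    (\<Sum>n\<in>N. (if t n = x then k n else 0) - (if h n = x then k n else 0))"
proof -
  have "net E k x = (\<Sum>e\<in>arcs D. dart E k x e) + (\<Sum>n\<in>N. dart E k x n)"
    unfolding net_def arcs_E using N fin_digraph.finite_arcs[OF fin]
    by (intro sum.union_disjoint) auto
  also have "(\<Sum>e\<in>arcs D. dart E k x e) = (\<Sum>e\<in>arcs D. if m e = x then dart D k v e else 0)"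
    by (rule sum.cong) (simp_all add: dart_old_arc[OF _ x])
  also have "(\<Sum>n\<in>N. dart E k x n) = (\<Sum>n\<in>N. (if t n = x then k n else 0) - (if h n = x then k n else 0))"
    by (rule sum.cong) (simp_all add: dart_def ends_new)
  finally show ?thesis .
qed

definition extend :: "('e \<Rightarrow> 'b) \<Rightarrow> ('e \<Rightarrow> 'b) \<Rightarrow> 'e \<Rightarrow> 'b" where
  "extend val f = (\<lambda>e\<in>arcs E. if e \<in> N then val e else f e)"

lemma extend_flow:
  fixes f val :: "'e \<Rightarrow> 'b::ab_group_add"
  assumes f: "f \<in> nz_flows D" and val: "\<And>n. n \<in> N \<Longrightarrow> val n \<noteq> 0"
    and bal: "\<And>x. x \<in> insert v W \<Longrightarrow>
      (\<Sum>e\<in>arcs D. if m e = x then dart D f v e else 0) +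
      (\<Sum>n\<in>N. (if t n = x then val n else 0) - (if h n = x then val n else 0)) = 0"
  shows "extend val f \<in> nz_flows E \<and> res (extend val f) = f"
proof -
  have old: "extend val f e = f e" if "e \<in> arcs D" for e
    using that N by (auto simp: extend_def arcs_E)
  have new: "extend val f n = val n" if "n \<in> N" for n
    using that by (simp add: extend_def arcs_E)
  have "net E (extend val f) x = 0" if "x \<in> verts E" for x
  proof (cases "x \<in> insert v W")
    case True
    have "net E (extend val f) x = (\<Sum>e\<in>arcs D. if m e = x then dart D f v e else 0) +
      (\<Sum>n\<in>N. (if t n = x then val n else 0) - (if h n = x then val n else 0))"
      unfolding net_new_vertex[OF True]
      by (intro arg_cong2[of _ _ _ _ plus] sum.cong) (simp_all add: old new dart_def)
    then show ?thesis using bal[OF True] by simp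
  next
    case False
    then have x: "x \<in> verts D" "x \<noteq> v" using that by (auto simp: verts_E)
    then have "net E (extend val f) x = net D f x"
      unfolding net_old_vertex[OF x] by (intro net_cong) (simp add: old)
    then show ?thesis
      using f x unfolding nz_flows_iff[OF fin] circ_def by simp
  qed
  then have "extend val f \<in> nz_flows E"
    using f val old new unfolding nz_flows_iff[OF fin] nz_flows_iff[OF fin_E] circ_def
    by (auto simp: extend_def arcs_E)
  moreover have "res (extend val f) = f"
    using f old unfolding nz_flows_iff[OF fin]
    by (intro extensionalityI[of _ "arcs D"]) (auto simp: res_def)
  ultimately show ?thesis ..
qed

lemma old_in_cut:
  assumes e: "e \<in> arcs D" and X: "X \<subseteq> verts E" "v \<notin> X"
  shows "e \<in> edge_cut E X \<longleftrightarrow> (e \<in> edge_cut D (X - W)) \<noteq> (e \<in> edge_cut D {v} \<and> m e \<in> X)"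
proof -
  interpret fin_digraph D by (rule fin)
  have "e \<in> arcs E" using e by (simp add: arcs_E)
  moreover have "tail D e \<notin> W" "head D e \<notin> W"
    using e old_notin_W by auto
  ultimately show ?thesis
    using e X(2) loopless[OF e] unfolding edge_cut_def mem_Collect_eq ends_old[OF e] by auto
qed

lemma new_in_cut: "n \<in> N \<Longrightarrow> n \<in> edge_cut E X \<longleftrightarrow> (t n \<in> X) \<noteq> (h n \<in> X)"
  by (simp add: edge_cut_def arcs_E ends_new)

text \<open>
  An old arc changes its status exactly if its end at \<open>v\<close> is moved into \<open>X\<close>; hence the symmetric
  difference.
\<close>

lemma card_cut_E:
  assumes X: "X \<subseteq> verts E" "v \<notin> X"
  defines "M \<equiv> {e \<in> edge_cut D {v}. m e \<in> X}"
  shows "card (edge_cut E X) = card (edge_cut D (X - W) - M) + card (M - edge_cut D (X - W)) +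
    card {n \<in> N. (t n \<in> X) \<noteq> (h n \<in> X)}"
proof -
  let ?C = "edge_cut D (X - W)" and ?N = "{n \<in> N. (t n \<in> X) \<noteq> (h n \<in> X)}"
  have sub: "?C \<subseteq> arcs D" "M \<subseteq> arcs D" by (auto simp: edge_cut_def M_def)
  have fins: "finite ?C" "finite M" "finite ?N"
    using finite_cut[OF fin] N by (auto simp: M_def)
  have "edge_cut E X = ((?C - M) \<union> (M - ?C)) \<union> ?N"
  proof (rule set_eqI)
    fix e
    show "e \<in> edge_cut E X \<longleftrightarrow> e \<in> ((?C - M) \<union> (M - ?C)) \<union> ?N"
    proof (cases "e \<in> N")
      case True
      then have "e \<notin> arcs D" using N by blast
      then show ?thesis using sub True new_in_cut[OF True] by blast
    next
      case False
      then show ?thesis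
        using sub old_in_cut[OF _ X, of e] by (cases "e \<in> arcs D") (auto simp: M_def edge_cut_def arcs_E)
    qed
  qed
  moreover have "((?C - M) \<union> (M - ?C)) \<inter> ?N = {}" "(?C - M) \<inter> (M - ?C) = {}"
    using sub N by blast+
  ultimately show ?thesis
    using fins by (simp add: card_Un_disjoint)
qed

lemma witness_E:
  assumes "f \<in> nz_flows E" "g \<in> nz_flows E" "\<not> (flow_step D)\<^sup>*\<^sup>* (res f) (res g)"
    and "\<And>X. X \<subseteq> verts E \<Longrightarrow> v \<notin> X \<Longrightarrow> X \<noteq> {} \<Longrightarrow> 3 \<le> card (edge_cut E X)"
  shows "witness E f g"
proof -
  have "v \<in> verts E" using v by (simp add: verts_E)
  then have "edge_conn 3 E"
    unfolding edge_conn_iff_avoiding[OF fin_E \<open>v \<in> verts E\<close>] using assms(4) by blast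
  then show ?thesis
    using assms fin_E loopless_E not_steps_if_res unfolding witness_def by blast
qed

lemma card_E: "card (verts E) = card (verts D) + card W" "card (arcs E) = card (arcs D) + card N"
  using W N fin_digraph.finite_verts[OF fin] fin_digraph.finite_arcs[OF fin]
  by (auto simp: verts_E arcs_E card_Un_disjoint Int_commute)

end

text \<open>
  Splitting \<open>p\<close> and \<open>q\<close> off from \<open>v\<close> by a new arc turns an edge cut \<open>{p, q, h}\<close> into the edge cut
  consisting of \<open>h\<close> and the new arc; all other edge cuts keep at least three arcs. The case
  \<open>X = verts D - {v}\<close> rules out degree 3 at \<open>v\<close>.
\<close>

definition splittable :: "('v, 'e) pre_digraph \<Rightarrow> 'v \<Rightarrow> 'e \<Rightarrow> 'e \<Rightarrow> bool" where
  "splittable D v p q \<longleftrightarrow>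
     (\<forall>X. X \<subseteq> verts D \<and> v \<notin> X \<and> card (edge_cut D X) = 3 \<longrightarrow> \<not> {p, q} \<subseteq> edge_cut D X)"

lemma witness_cut:
  assumes "witness D f g" "v \<in> verts D" "X \<subseteq> verts D" "v \<notin> X" "X \<noteq> {}"
  shows "3 \<le> card (edge_cut D X)"
  using assms unfolding witness_def edge_conn_def by blast

lemma sum_two_removed:
  fixes k :: "'e \<Rightarrow> 'b::ab_group_add"
  assumes "finite A" "p \<in> A" "q \<in> A" "p \<noteq> q" "sum k A = 0"
  shows "(\<Sum>e\<in>A. if e \<noteq> p \<and> e \<noteq> q then k e else 0) = - k p - k q"
proof -
  have "sum k A = k p + (k q + sum k (A - {p} - {q}))"
    using assms by (simp add: sum.remove[of A p] sum.remove[of "A - {p}" q])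
  moreover have "(\<Sum>e\<in>A. if e \<noteq> p \<and> e \<noteq> q then k e else 0) = sum k (A - {p} - {q})"
    using assms(1) by (intro sum.mono_neutral_cong_right) auto
  ultimately show ?thesis
    using assms(5) by (simp add: algebra_simps add_eq_0_iff)
qed

lemma split_off:
  fixes D :: "(nat, nat) pre_digraph" and f g :: "nat \<Rightarrow> 'a::ab_group_add"
  assumes w: "witness D f g" and v: "v \<in> verts D" and p: "p \<in> edge_cut D {v}" and q: "q \<in> edge_cut D {v}"
    and pq: "p \<noteq> q" and sp: "splittable D v p q"
    and nz: "dart D f v p + dart D f v q \<noteq> 0" "dart D g v p + dart D g v q \<noteq> 0"
  shows "\<exists>(D' :: (nat, nat) pre_digraph) (f' :: nat \<Rightarrow> 'a) g'. witness D' f' g' \<and>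
    card (verts D') = card (verts D) + 1 \<and> card (arcs D') = card (arcs D) + 1"
proof -
  have D: "fin_digraph D" and f: "f \<in> nz_flows D" and g: "g \<in> nz_flows D"
    and ns: "\<not> (flow_step D)\<^sup>*\<^sup>* f g"
    using w by (auto simp: witness_def)
  interpret D: fin_digraph D by fact
  obtain x where x: "x \<notin> verts D"
    using ex_new_if_finite[OF infinite_UNIV_nat D.finite_verts] by blast
  obtain n where n: "n \<notin> arcs D"
    using ex_new_if_finite[OF infinite_UNIV_nat D.finite_arcs] by blast
  have vx: "v \<noteq> x" using v x by blast
  define m where "m e = (if e = p \<or> e = q then x else v)" for e :: nat
  interpret expansion D v m "{x}" "{n}" "\<lambda>_. v" "\<lambda>_. x"
    by unfold_locales (use w v x n vx in \<open>auto simp: m_def witness_def\<close>)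
  have pqA: "p \<in> arcs D" "q \<in> arcs D" using p q by (auto simp: edge_cut_def)
  have ext: "extend (\<lambda>_. dart D k v p + dart D k v q) k \<in> nz_flows E \<and>
      res (extend (\<lambda>_. dart D k v p + dart D k v q) k) = k"
    if k: "k \<in> nz_flows D" and k0: "dart D k v p + dart D k v q \<noteq> 0" for k :: "nat \<Rightarrow> 'a"
  proof -
    have net0: "(\<Sum>e\<in>arcs D. dart D k v e) = 0"
      using k v unfolding nz_flows_iff[OF D] circ_def net_def by blast
    have "(\<Sum>e\<in>arcs D. if m e = v then dart D k v e else 0) =
        (\<Sum>e\<in>arcs D. if e \<noteq> p \<and> e \<noteq> q then dart D k v e else 0)"
      using vx by (intro sum.cong) (auto simp: m_def)
    also have "\<dots> = - dart D k v p - dart D k v q"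
      by (rule sum_two_removed[OF D.finite_arcs pqA pq net0])
    finally have 1: "(\<Sum>e\<in>arcs D. if m e = v then dart D k v e else 0) = - dart D k v p - dart D k v q" .
    have "(\<Sum>e\<in>arcs D. if m e = x then dart D k v e else 0) = (\<Sum>e\<in>{p, q}. dart D k v e)"
      using vx pqA by (intro sum.mono_neutral_cong_right) (auto simp: m_def)
    then have 2: "(\<Sum>e\<in>arcs D. if m e = x then dart D k v e else 0) = dart D k v p + dart D k v q"
      using pq by simp
    show ?thesis
    proof (rule extend_flow[OF k])
      fix y assume "y \<in> insert v {x}"
      then have "y = v \<or> y = x" by blast
      then show "(\<Sum>e\<in>arcs D. if m e = y then dart D k v e else 0) +
          (\<Sum>i\<in>{n}. (if v = y then dart D k v p + dart D k v q else 0) -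
             (if x = y then dart D k v p + dart D k v q else 0)) = 0"
        using 1 2 vx by (elim disjE) simp_all
    qed (use k0 in simp)
  qed
  have "3 \<le> card (edge_cut E X)" if X: "X \<subseteq> verts E" "v \<notin> X" "X \<noteq> {}" for X
  proof -
    define C M NX where "C = edge_cut D (X - {x})" and "M = {e \<in> edge_cut D {v}. m e \<in> X}"
      and "NX = {i \<in> {n}. (v \<in> X) \<noteq> (x \<in> X)}"
    have card: "card (edge_cut E X) = card (C - M) + card (M - C) + card NX"
      unfolding C_def M_def NX_def by (rule card_cut_E[OF X(1,2)])
    have finC: "finite C" unfolding C_def by (rule finite_cut[OF D])
    have XC: "3 \<le> card C" if "X - {x} \<noteq> {}"
      unfolding C_def using X that by (intro witness_cut[OF w v]) (auto simp: verts_E)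
    show ?thesis
    proof (cases "x \<in> X")
      case False
      then have "M = {}" using X(2) by (auto simp: M_def m_def)
      then show ?thesis using card XC X False by auto
    next
      case True
      then have M: "M = {p, q}" and NX: "card NX = 1"
        using X(2) p q by (auto simp: M_def NX_def m_def)
      show ?thesis
      proof (cases "X - {x} = {}")
        case True
        then have "C = {}" unfolding C_def by (auto simp: edge_cut_def)
        then show ?thesis using card M NX pq by simp
      next
        case False
        have "2 \<le> card (C - M)"
        proof (cases "{p, q} \<subseteq> C")
          case True
          have "X - {x} \<subseteq> verts D" "v \<notin> X - {x}"
            using X by (auto simp: verts_E)
          then have "card C \<noteq> 3"
            using sp True unfolding splittable_def C_def by blast
          then have "4 \<le> card C" using XC False by linarith
          then show ?thesis
            using card_Diff_subset[of M C] True M pq by simp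
        next
          case False
          then have "C - M = C - {p} \<or> C - M = C - {q}"
            unfolding M by blast
          moreover have "card C - 1 \<le> card (C - {i})" for i
            using diff_card_le_card_Diff[of "{i}" C] by simp
          ultimately have "card C - 1 \<le> card (C - M)"
            by (elim disjE) simp_all
          then show ?thesis using XC \<open>X - {x} \<noteq> {}\<close> by linarith
        qed
        then show ?thesis using card NX by linarith
      qed
    qed
  qed
  then have "witness E (extend (\<lambda>_. dart D f v p + dart D f v q) f) (extend (\<lambda>_. dart D g v p + dart D g v q) g)"
    using ext[OF f nz(1)] ext[OF g nz(2)] ns by (intro witness_E) auto
  moreover have "card (verts E) = card (verts D) + 1" "card (arcs E) = card (arcs D) + 1"
    by (simp_all add: card_E)
  ultimately show ?thesis by blast
qed

text \<open>
  The arcs \<open>e1\<close> and \<open>e2\<close> are subdivided and the subdividing vertices joined by a rung carrying \<open>tf\<close>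
  and \<open>tg\<close>, respectively. The rung protects one of the new arcs: a 3-edge-cut through \<open>b2\<close> and \<open>e3\<close> that
  separates the ends of the rung contains the rung, which leaves only \<open>e2\<close> and \<open>e3\<close> for the old graph, and
  otherwise it contains \<open>b1\<close> and comes from the edge cut \<open>{e1, e2, e3}\<close>.
\<close>

lemma add_rung:
  fixes D :: "(nat, nat) pre_digraph" and f g :: "nat \<Rightarrow> 'a::ab_group_add"
  assumes w: "witness D f g" and v: "v \<in> verts D" and e1: "e1 \<in> edge_cut D {v}" and e2: "e2 \<in> edge_cut D {v}"
    and e12: "e1 \<noteq> e2"
    and tf: "tf \<noteq> 0" "dart D f v e1 + tf \<noteq> 0" "dart D f v e2 - tf \<noteq> 0"
    and tg: "tg \<noteq> 0" "dart D g v e1 + tg \<noteq> 0" "dart D g v e2 - tg \<noteq> 0"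
  obtains D' :: "(nat, nat) pre_digraph" and f' g' :: "nat \<Rightarrow> 'a" and b1 b2
  where "witness D' f' g'" "card (verts D') = card (verts D) + 2" "card (arcs D') = card (arcs D) + 3"
    "v \<in> verts D'" "b1 \<noteq> b2" "b1 \<in> edge_cut D' {v}" "b2 \<in> edge_cut D' {v}"
    "dart D' f' v b1 = dart D f v e1 + tf" "dart D' f' v b2 = dart D f v e2 - tf"
    "dart D' g' v b1 = dart D g v e1 + tg" "dart D' g' v b2 = dart D g v e2 - tg"
    "\<And>e3. e3 \<in> edge_cut D {v} \<Longrightarrow> e3 \<notin> {e1, e2} \<Longrightarrow> e3 \<in> edge_cut D' {v} \<and> e3 \<notin> {b1, b2} \<and>
      dart D' f' v e3 = dart D f v e3 \<and> dart D' g' v e3 = dart D g v e3"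
    "\<And>e3. e3 \<in> edge_cut D {v} \<Longrightarrow> e3 \<notin> {e1, e2} \<Longrightarrow>
      (\<And>X. X \<subseteq> verts D \<Longrightarrow> v \<notin> X \<Longrightarrow> edge_cut D X \<noteq> {e1, e2, e3}) \<Longrightarrow> splittable D' v b2 e3"
proof -
  have D: "fin_digraph D" and f: "f \<in> nz_flows D" and g: "g \<in> nz_flows D"
    and ns: "\<not> (flow_step D)\<^sup>*\<^sup>* f g"
    using w by (auto simp: witness_def)
  interpret D: fin_digraph D by fact
  obtain w1 where w1: "w1 \<notin> verts D"
    using ex_new_if_finite[OF infinite_UNIV_nat D.finite_verts] by blast
  obtain w2 where w2: "w2 \<notin> insert w1 (verts D)"
    using ex_new_if_finite[OF infinite_UNIV_nat, of "insert w1 (verts D)"] D.finite_verts by blast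
  obtain b1 where b1: "b1 \<notin> arcs D"
    using ex_new_if_finite[OF infinite_UNIV_nat D.finite_arcs] by blast
  obtain b2 where b2: "b2 \<notin> insert b1 (arcs D)"
    using ex_new_if_finite[OF infinite_UNIV_nat, of "insert b1 (arcs D)"] D.finite_arcs by blast
  obtain r where r: "r \<notin> insert b2 (insert b1 (arcs D))"
    using ex_new_if_finite[OF infinite_UNIV_nat, of "insert b2 (insert b1 (arcs D))"] D.finite_arcs by blast
  have ws: "v \<noteq> w1" "v \<noteq> w2" "w1 \<noteq> w2" and bs: "b1 \<noteq> b2" "b1 \<noteq> r" "b2 \<noteq> r"
    using v w1 w2 b1 b2 r by auto
  define m where "m e = (if e = e1 then w1 else if e = e2 then w2 else v)" for e :: nat
  define t where "t i = (if i = r then w1 else v)" for i :: nat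
  define h where "h i = (if i = b1 then w1 else w2)" for i :: nat
  have m_simps: "m e1 = w1" "m e2 = w2" "\<And>e. e \<noteq> e1 \<Longrightarrow> e \<noteq> e2 \<Longrightarrow> m e = v"
    using e12 by (auto simp: m_def)
  have th_simps: "t r = w1" "t b1 = v" "t b2 = v" "h r = w2" "h b1 = w1" "h b2 = w2"
    using bs by (auto simp: t_def h_def)
  interpret expansion D v m "{w1, w2}" "{b1, b2, r}" t h
    by unfold_locales (use w v w1 w2 b1 b2 r ws th_simps in \<open>auto simp: m_def witness_def\<close>)
  have eA: "e1 \<in> arcs D" "e2 \<in> arcs D" using e1 e2 by (auto simp: edge_cut_def)
  define val where "val k s i = (if i = b1 then dart D k v e1 + s else if i = b2 then dart D k v e2 - s else s)"
    for k :: "nat \<Rightarrow> 'a" and s i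
  have val_simps: "val k s b1 = dart D k v e1 + s" "val k s b2 = dart D k v e2 - s" "val k s r = s" for k s
    using bs by (auto simp: val_def)
  have ext: "extend (val k s) k \<in> nz_flows E \<and> res (extend (val k s) k) = k"
    if k: "k \<in> nz_flows D" and s: "s \<noteq> 0" "dart D k v e1 + s \<noteq> 0" "dart D k v e2 - s \<noteq> 0"
    for k :: "nat \<Rightarrow> 'a" and s
  proof -
    let ?d = "dart D k v"
    have net0: "(\<Sum>e\<in>arcs D. ?d e) = 0"
      using k v unfolding nz_flows_iff[OF D] circ_def net_def by blast
    have "(\<Sum>e\<in>arcs D. if m e = v then ?d e else 0) = (\<Sum>e\<in>arcs D. if e \<noteq> e1 \<and> e \<noteq> e2 then ?d e else 0)"
      using ws by (intro sum.cong) (auto simp: m_def)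
    also have "\<dots> = - ?d e1 - ?d e2"
      by (rule sum_two_removed[OF D.finite_arcs eA e12 net0])
    finally have 0: "(\<Sum>e\<in>arcs D. if m e = v then ?d e else 0) = - ?d e1 - ?d e2" .
    have "(\<Sum>e\<in>arcs D. if m e = w1 then ?d e else 0) = (\<Sum>e\<in>{e1}. ?d e)"
      using ws eA by (intro sum.mono_neutral_cong_right) (auto simp: m_def)
    then have 1: "(\<Sum>e\<in>arcs D. if m e = w1 then ?d e else 0) = ?d e1" by simp
    have "(\<Sum>e\<in>arcs D. if m e = w2 then ?d e else 0) = (\<Sum>e\<in>{e2}. ?d e)"
      using ws eA e12 by (intro sum.mono_neutral_cong_right) (auto simp: m_def)
    then have 2: "(\<Sum>e\<in>arcs D. if m e = w2 then ?d e else 0) = ?d e2" by simp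
    have sumN: "(\<Sum>n\<in>{b1, b2, r}. F n) = F b1 + F b2 + F r" for F :: "nat \<Rightarrow> 'a"
      using bs by (simp add: add.assoc)
    show ?thesis
    proof (rule extend_flow[OF k])
      fix n assume "n \<in> {b1, b2, r}"
      then show "val k s n \<noteq> 0" using s by (auto simp: val_simps)
    next
      fix x assume "x \<in> insert v {w1, w2}"
      then have "x = v \<or> x = w1 \<or> x = w2" by blast
      then show "(\<Sum>e\<in>arcs D. if m e = x then ?d e else 0) +
          (\<Sum>n\<in>{b1, b2, r}. (if t n = x then val k s n else 0) - (if h n = x then val k s n else 0)) = 0"
        unfolding sumN th_simps val_simps using ws 0 1 2 by (elim disjE) simp_all
    qed
  qed
  have Mset: "{e \<in> edge_cut D {v}. m e \<in> X} = (if w1 \<in> X then {e1} else {}) \<union> (if w2 \<in> X then {e2} else {})"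
    if "v \<notin> X" for X
    using that e1 e2 e12 by (auto simp: m_def)
  have Nset: "{n \<in> {b1, b2, r}. (t n \<in> X) \<noteq> (h n \<in> X)} =
      (if w1 \<in> X then {b1} else {}) \<union> (if w2 \<in> X then {b2} else {}) \<union>
      (if (w1 \<in> X) \<noteq> (w2 \<in> X) then {r} else {})"
    if "v \<notin> X" for X
    using that th_simps bs by auto
  have ec: "3 \<le> card (edge_cut E X)" if X: "X \<subseteq> verts E" "v \<notin> X" "X \<noteq> {}" for X
  proof -
    define C M NX where "C = edge_cut D (X - {w1, w2})" and "M = {e \<in> edge_cut D {v}. m e \<in> X}"
      and "NX = {n \<in> {b1, b2, r}. (t n \<in> X) \<noteq> (h n \<in> X)}"
    have card: "card (edge_cut E X) = card (C - M) + card (M - C) + card NX"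
      unfolding C_def M_def NX_def by (rule card_cut_E[OF X(1,2)])
    have XC: "3 \<le> card C" if "X - {w1, w2} \<noteq> {}"
      unfolding C_def using X that by (intro witness_cut[OF w v]) (auto simp: verts_E)
    have C0: "C = {}" if "X - {w1, w2} = {}"
      unfolding C_def that by (simp add: edge_cut_def)
    have finM: "finite M" unfolding M_def using finite_cut[OF D] by simp
    have "card C - card M \<le> card (C - M)"
      by (rule diff_card_le_card_Diff[OF finM])
    then show ?thesis
      using card XC C0 X(3) Mset[OF X(2), folded M_def] Nset[OF X(2), folded NX_def] bs e12
      by (cases "w1 \<in> X"; cases "w2 \<in> X"; cases "X - {w1, w2} = {}") auto
  qed
  have wit: "witness E (extend (val f tf) f) (extend (val g tg) g)"
    using ext[OF f tf] ext[OF g tg] ns ec by (intro witness_E) auto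
  have dart_new: "dart E (extend (val k s) k) v b1 = dart D k v e1 + s"
    "dart E (extend (val k s) k) v b2 = dart D k v e2 - s" for k s
    using ws th_simps ends_new by (auto simp: dart_def extend_def arcs_E val_simps)
  have third: "e3 \<in> edge_cut E {v} \<and> e3 \<notin> {b1, b2}" "dart E (extend (val k s) k) v e3 = dart D k v e3"
    if e3: "e3 \<in> edge_cut D {v}" "e3 \<notin> {e1, e2}" for e3 k s
  proof -
    have A: "e3 \<in> arcs D" using e3 by (simp add: edge_cut_def)
    then have "e3 \<notin> {b1, b2, r}" using b1 b2 r by auto
    moreover have "m e3 = v" using e3 m_simps(3) by blast
    ultimately show "e3 \<in> edge_cut E {v} \<and> e3 \<notin> {b1, b2}" "dart E (extend (val k s) k) v e3 = dart D k v e3"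
      using A e3 by (auto simp: edge_cut_def arcs_E ends_old dart_def extend_def)
  qed
  have split: "splittable E v b2 e3"
    if e3: "e3 \<in> edge_cut D {v}" "e3 \<notin> {e1, e2}"
      and no: "\<And>X. X \<subseteq> verts D \<Longrightarrow> v \<notin> X \<Longrightarrow> edge_cut D X \<noteq> {e1, e2, e3}" for e3
    unfolding splittable_def
  proof (intro allI impI notI)
    fix X assume X: "X \<subseteq> verts E \<and> v \<notin> X \<and> card (edge_cut E X) = 3" and sub: "{b2, e3} \<subseteq> edge_cut E X"
    define Y where "Y = X - {w1, w2}"
    have Y: "Y \<subseteq> verts D" "v \<notin> Y"
      using X by (auto simp: Y_def verts_E)
    have A: "e3 \<in> arcs D" using e3 by (simp add: edge_cut_def)
    have e3_old: "b1 \<noteq> e3" "b2 \<noteq> e3" "r \<noteq> e3"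
      using A b1 b2 r by blast+
    have fE: "finite (edge_cut E X)" by (rule finite_cut[OF fin_E])
    have "b2 \<in> edge_cut E X" using sub by simp
    then have w2X: "w2 \<in> X"
      using new_in_cut[of b2 X] X by (simp add: th_simps)
    have old: "e \<in> edge_cut D Y \<longleftrightarrow> (e \<in> edge_cut E X) \<noteq> (e \<in> edge_cut D {v} \<and> m e \<in> X)" if "e \<in> arcs D" for e
      using old_in_cut[OF that, of X] X unfolding Y_def by blast
    have Yarcs: "edge_cut D Y \<subseteq> arcs D" by (auto simp: edge_cut_def)
    have atv: "e \<in> edge_cut D {v} \<and> m e \<in> X \<longleftrightarrow> (e = e1 \<and> w1 \<in> X) \<or> e = e2" for e
      using X w2X e1 e2 e12 by (auto simp: m_def)
    have e3Y: "e3 \<in> edge_cut D Y"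
      using old[OF A] sub e3(2) unfolding atv by blast
    show False
    proof (cases "w1 \<in> X")
      case True
      then have "b1 \<in> edge_cut E X"
        using new_in_cut[of b1 X] X by (simp add: th_simps)
      then have "{b1, b2, e3} \<subseteq> edge_cut E X" using sub by blast
      moreover have "card {b1, b2, e3} = 3" using bs e3_old by simp
      ultimately have eq: "edge_cut E X = {b1, b2, e3}"
        using card_subset_eq[OF fE] X by metis
      have "e \<in> edge_cut D Y \<longleftrightarrow> e \<in> {e1, e2, e3}" for e
        using old[of e] atv[of e] Yarcs A eA b1 b2 True e3 unfolding eq
        by (cases "e \<in> arcs D") auto
      then have "edge_cut D Y = {e1, e2, e3}" by blast
      then show False using no[OF Y] by blast
    next
      case False
      then have "r \<in> edge_cut E X"
        using new_in_cut[of r X] w2X by (simp add: th_simps)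
      then have "{r, b2, e3} \<subseteq> edge_cut E X" using sub by blast
      moreover have "card {r, b2, e3} = 3" using bs e3_old by simp
      ultimately have eq: "edge_cut E X = {r, b2, e3}"
        using card_subset_eq[OF fE] X by metis
      have "e \<in> edge_cut D Y \<longleftrightarrow> e \<in> {e2, e3}" for e
        using old[of e] atv[of e] Yarcs A eA r b2 False e3 unfolding eq
        by (cases "e \<in> arcs D") auto
      then have "edge_cut D Y = {e2, e3}" by blast
      moreover have "Y \<noteq> {}" using e3Y by (auto simp: edge_cut_def)
      ultimately show False
        using witness_cut[OF w v Y] by (simp add: card_insert_if split: if_splits)
    qed
  qed
  have b_cut: "b1 \<in> edge_cut E {v}" "b2 \<in> edge_cut E {v}"
    using ws by (simp_all add: new_in_cut th_simps)
  have "card (verts E) = card (verts D) + 2" "card (arcs E) = card (arcs D) + 3"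
    using ws bs by (simp_all add: card_E)
  moreover have "v \<in> verts E" using v by (simp add: verts_E)
  ultimately show thesis
    using that[of E "extend (val f tf) f" "extend (val g tg) g" b1 b2] wit bs(1) b_cut dart_new third split
    by blast
qed

section \<open>Reduction to cubic graphs\<close>

lemma avoid_three:
  assumes "4 \<le> card (UNIV :: ('a::finite) set)"
  obtains t :: "'a::finite" where "t \<noteq> x" "t \<noteq> y" "t \<noteq> z"
proof -
  have "card {x, y, z} \<le> 3"
    by (simp add: card_insert_if)
  then have "{x, y, z} \<noteq> UNIV"
    using assms by auto
  then show thesis using that by blast
qed

text \<open>
  With \<open>s = a1 + a2\<close>, the second rail takes the values \<open>a2\<close>, \<open>y\<close>, \<open>y'\<close>; neighbouring values differ
  because rungs are nonzero, and \<open>0\<close> and \<open>s\<close> are forbidden because both rails are nonzero. So \<open>y\<close>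
  avoids \<open>0\<close>, \<open>s\<close>, \<open>a2\<close>, and \<open>y'\<close> avoids \<open>0\<close>, \<open>s\<close>, \<open>y\<close>, \<open>- a3\<close>. The latter are at most three
  values if \<open>s = 0\<close> or \<open>- a3 = s\<close>, and also for the choice \<open>y = - a3\<close>.
\<close>

lemma rung_values:
  fixes a1 a2 a3 :: "'a::{finite, ab_group_add}"
  assumes "4 \<le> card (UNIV :: 'a set)" and nz: "a2 \<noteq> 0" "a3 \<noteq> 0" and ord: "a2 + a3 = 0 \<longrightarrow> a1 + a2 = 0"
  shows "\<exists>t t'. t \<noteq> 0 \<and> a1 + t \<noteq> 0 \<and> a2 - t \<noteq> 0 \<and> t' \<noteq> 0 \<and> a1 + t + t' \<noteq> 0 \<and>
    a2 - t - t' \<noteq> 0 \<and> a2 - t - t' + a3 \<noteq> 0"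
proof -
  let ?s = "a1 + a2"
  obtain y y' where y: "y \<noteq> 0" "y \<noteq> ?s" "y \<noteq> a2" and y': "y' \<noteq> 0" "y' \<noteq> ?s" "y' \<noteq> y" "y' \<noteq> - a3"
  proof (cases "?s = 0")
    case True
    obtain y where y: "y \<noteq> 0" "y \<noteq> a2" using avoid_three[OF assms(1)] by metis
    obtain y' where "y' \<noteq> 0" "y' \<noteq> y" "y' \<noteq> - a3" using avoid_three[OF assms(1)] by metis
    with y show thesis using that True by metis
  next
    case False
    show thesis
    proof (cases "- a3 = ?s")
      case True
      obtain y where y: "y \<noteq> 0" "y \<noteq> ?s" "y \<noteq> a2" using avoid_three[OF assms(1)] by metis
      obtain y' where "y' \<noteq> 0" "y' \<noteq> ?s" "y' \<noteq> y" using avoid_three[OF assms(1)] by metis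
      with y show thesis using that True by metis
    next
      case neq: False
      obtain y' where "y' \<noteq> 0" "y' \<noteq> ?s" "y' \<noteq> - a3" using avoid_three[OF assms(1)] by metis
      moreover have "- a3 \<noteq> a2"
        using ord False by (metis add.right_inverse add.commute)
      ultimately show thesis
        using that[of "- a3" y'] neq nz(2) by simp
    qed
  qed
  show ?thesis
  proof (intro exI conjI)
    show "a2 - y \<noteq> 0" using y(3) by simp
    show "a1 + (a2 - y) \<noteq> 0" using y(2) by (simp add: algebra_simps)
    show "a2 - (a2 - y) \<noteq> 0" using y(1) by simp
    show "y - y' \<noteq> 0" using y'(3) by simp
    show "a1 + (a2 - y) + (y - y') \<noteq> 0" using y'(2) by (simp add: algebra_simps)
    show "a2 - (a2 - y) - (y - y') \<noteq> 0" using y'(1) by simp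
    show "a2 - (a2 - y) - (y - y') + a3 \<noteq> 0" using y'(4) by (simp add: add_eq_0_iff2)
  qed
qed

text \<open>
  The three pairs are labelled by subsets of \<open>{P, Q}\<close>, and of three such subsets two are comparable.
  Any two of the pairs share an element, which becomes \<open>e2\<close>.
\<close>

lemma arrange_three:
  assumes "x1 \<noteq> x2" "x1 \<noteq> x3" "x2 \<noteq> x3"
    and "\<And>x y. P x y \<Longrightarrow> P y x" "\<And>x y. Q x y \<Longrightarrow> Q y x"
  obtains e1 e2 e3 where "{e1, e2, e3} = {x1, x2, x3}" "e1 \<noteq> e2" "e1 \<noteq> e3" "e2 \<noteq> e3"
    "P e2 e3 \<longrightarrow> P e1 e2" "Q e2 e3 \<longrightarrow> Q e1 e2"
proof -
  have sym: "P x y = P y x" "Q x y = Q y x" for x y using assms(4,5) by blast+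
  define T where "T a b c \<longleftrightarrow> (P b c \<longrightarrow> P a b) \<and> (Q b c \<longrightarrow> Q a b)" for a b c
  have "T x1 x2 x3 \<or> T x3 x2 x1 \<or> T x2 x1 x3 \<or> T x3 x1 x2 \<or> T x1 x3 x2 \<or> T x2 x3 x1"
    unfolding T_def
    using sym(1)[of x1 x2] sym(1)[of x1 x3] sym(1)[of x2 x3]
      sym(2)[of x1 x2] sym(2)[of x1 x3] sym(2)[of x2 x3] by argo
  then show thesis
  proof (elim disjE)
    assume "T x1 x2 x3" then show thesis using that[of x1 x2 x3] assms unfolding T_def by blast
  next
    assume "T x3 x2 x1" then show thesis using that[of x3 x2 x1] assms unfolding T_def by blast
  next
    assume "T x2 x1 x3" then show thesis using that[of x2 x1 x3] assms unfolding T_def by blast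
  next
    assume "T x3 x1 x2" then show thesis using that[of x3 x1 x2] assms unfolding T_def by blast
  next
    assume "T x1 x3 x2" then show thesis using that[of x1 x3 x2] assms unfolding T_def by blast
  next
    assume "T x2 x3 x1" then show thesis using that[of x2 x3 x1] assms unfolding T_def by blast
  qed
qed

lemma card_cut_vertex:
  assumes D: "fin_digraph D" and nl: "\<forall>e\<in>arcs D. tail D e \<noteq> head D e"
  shows "card (edge_cut D {v}) = card {e \<in> arcs D. tail D e = v} + card {e \<in> arcs D. head D e = v}"
proof -
  have "edge_cut D {v} = {e \<in> arcs D. tail D e = v} \<union> {e \<in> arcs D. head D e = v}"
    "{e \<in> arcs D. tail D e = v} \<inter> {e \<in> arcs D. head D e = v} = {}"
    using nl by (auto simp: edge_cut_def)
  then show ?thesis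
    using fin_digraph.finite_arcs[OF D] by (simp add: card_Un_disjoint)
qed

lemma handshake:
  assumes D: "fin_digraph D" and nl: "\<forall>e\<in>arcs D. tail D e \<noteq> head D e"
  shows "(\<Sum>v\<in>verts D. card (edge_cut D {v})) = 2 * card (arcs D)"
proof -
  interpret fin_digraph D by fact
  have "tail D ` arcs D \<subseteq> verts D" "head D ` arcs D \<subseteq> verts D" by auto
  then show ?thesis
    unfolding card_cut_vertex[OF D nl] sum.distrib
    by (simp add: sum_card_fibres)
qed

lemma witness_degree:
  assumes w: "witness D f g" and "3 \<le> card (verts D)" and v: "v \<in> verts D"
  shows "3 \<le> card (edge_cut D {v})"
proof -
  have "verts D \<noteq> {v}" using assms(2) by auto
  then show ?thesis
    using w v unfolding witness_def edge_conn_def by blast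
qed

lemma dart_nonzero:
  assumes w: "witness D f g" and e: "e \<in> edge_cut D {v}"
  shows "dart D f v e \<noteq> 0" "dart D g v e \<noteq> 0"
proof -
  have D: "fin_digraph D" using w by (simp add: witness_def)
  have "e \<in> arcs D" using e by (simp add: edge_cut_def)
  then have "f e \<noteq> 0" "g e \<noteq> 0"
    using w unfolding witness_def nz_flows_iff[OF D] by blast+
  then show "dart D f v e \<noteq> 0" "dart D g v e \<noteq> 0"
    using e by (auto simp: dart_def edge_cut_def)
qed

text \<open>
  The far ends of \<open>e1\<close>, \<open>e2\<close> and \<open>e4\<close> lie in \<open>Y\<close>, so that only \<open>e3\<close> could leave \<open>X - Y\<close>.
\<close>

lemma not_both_three_cuts:
  assumes w: "witness D f g" and v: "v \<in> verts D"
    and e: "{e1, e2, e3, e4} \<subseteq> edge_cut D {v}" "e3 \<noteq> e1" "e3 \<noteq> e2" "e3 \<noteq> e4"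
    and X: "X \<subseteq> verts D" "v \<notin> X" "edge_cut D X = {e1, e2, e3}"
    and Y: "Y \<subseteq> verts D" "v \<notin> Y" "edge_cut D Y = {e1, e2, e4}"
  shows False
proof -
  define far where "far e = (if tail D e = v then head D e else tail D e)" for e
  have cut_far: "e \<in> edge_cut D Z \<longleftrightarrow> far e \<in> Z" if "e \<in> edge_cut D {v}" "v \<notin> Z" for e Z
    using that by (auto simp: edge_cut_def far_def)
  have sub: "edge_cut D (X - Y) \<subseteq> edge_cut D X \<union> edge_cut D Y"
    by (auto simp: edge_cut_def)
  have "e \<notin> edge_cut D (X - Y)" if "e \<in> {e1, e2, e4}" for e
  proof -
    have "e \<in> edge_cut D {v}" "e \<in> edge_cut D Y" using that e Y(3) by auto
    then have "far e \<in> Y" using cut_far Y(2) by blast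
    then show ?thesis
      using cut_far[of e "X - Y"] \<open>e \<in> edge_cut D {v}\<close> X(2) by blast
  qed
  then have "edge_cut D (X - Y) \<subseteq> {e3}"
    using sub X(3) Y(3) by blast
  then have "card (edge_cut D (X - Y)) \<le> 1"
    using card_mono[of "{e3}" "edge_cut D (X - Y)"] by simp
  moreover have "far e3 \<in> X" "far e3 \<notin> Y"
    using cut_far[of e3 X] cut_far[of e3 Y] e X(2,3) Y(2,3) by auto
  then have "3 \<le> card (edge_cut D (X - Y))"
    using X Y by (intro witness_cut[OF w v]) auto
  ultimately show False by simp
qed

text \<open>
  Two rungs are needed: a single one fixes the new values too tightly if the group has order 4.
  The number \<open>2 |E| - 3 |V|\<close>, which measures the distance from being cubic, drops by 1.
\<close>

lemma reduce_vertex: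
  fixes D :: "(nat, nat) pre_digraph" and f g :: "nat \<Rightarrow> 'a::{finite, ab_group_add}"
  assumes A: "4 \<le> card (UNIV :: 'a set)" and w: "witness D f g" and v: "v \<in> verts D" "4 \<le> card (edge_cut D {v})"
  shows "\<exists>(D' :: (nat, nat) pre_digraph) (f' :: nat \<Rightarrow> 'a) g'. witness D' f' g' \<and>
    card (verts D') = card (verts D) + 5 \<and> card (arcs D') = card (arcs D) + 7"
proof -
  obtain T where T: "T \<subseteq> edge_cut D {v}" "card T = 4" "finite T"
    using obtain_subset_with_card_n[OF v(2)] by metis
  obtain xs where xs: "set xs = T" "distinct xs"
    using finite_distinct_list[OF T(3)] by blast
  then have "length xs = 4" using T(2) distinct_card by metis
  then obtain c1 c2 c3 c4 where c: "xs = [c1, c2, c3, c4]"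
    by (auto simp: length_Suc_conv numeral_eq_Suc)
  have cv: "{c1, c2, c3, c4} \<subseteq> edge_cut D {v}" and dist: "distinct [c1, c2, c3, c4]"
    using xs c T(1) by auto
  obtain d where d: "d \<in> {c3, c4}" "\<And>X. X \<subseteq> verts D \<Longrightarrow> v \<notin> X \<Longrightarrow> edge_cut D X \<noteq> {c1, c2, d}"
    using not_both_three_cuts[OF w v(1) cv] dist by (metis distinct_length_2_or_more insertCI)
  have cd: "c1 \<noteq> c2" "c1 \<noteq> d" "c2 \<noteq> d" "{c1, c2, d} \<subseteq> edge_cut D {v}"
    using d(1) dist cv by auto
  obtain e1 e2 e3 where e: "{e1, e2, e3} = {c1, c2, d}" "e1 \<noteq> e2" "e1 \<noteq> e3" "e2 \<noteq> e3"
    and ordf: "dart D f v e2 + dart D f v e3 = 0 \<longrightarrow> dart D f v e1 + dart D f v e2 = 0"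
    and ordg: "dart D g v e2 + dart D g v e3 = 0 \<longrightarrow> dart D g v e1 + dart D g v e2 = 0"
    by (rule arrange_three[OF cd(1-3), of "\<lambda>x y. dart D f v x + dart D f v y = 0"
          "\<lambda>x y. dart D g v x + dart D g v y = 0"]) (simp_all only: add.commute)
  have ev: "e1 \<in> edge_cut D {v}" "e2 \<in> edge_cut D {v}" "e3 \<in> edge_cut D {v}"
    using e(1) cd(4) by blast+
  have no3: "edge_cut D X \<noteq> {e1, e2, e3}" if "X \<subseteq> verts D" "v \<notin> X" for X
    using d(2)[OF that] e(1) by simp
  obtain s s' where s: "s \<noteq> 0" "dart D f v e1 + s \<noteq> 0" "dart D f v e2 - s \<noteq> 0" "s' \<noteq> 0"
    "dart D f v e1 + s + s' \<noteq> 0" "dart D f v e2 - s - s' \<noteq> 0"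
    "dart D f v e2 - s - s' + dart D f v e3 \<noteq> 0"
    using rung_values[OF A dart_nonzero(1)[OF w ev(2)] dart_nonzero(1)[OF w ev(3)] ordf] by blast
  obtain t t' where t: "t \<noteq> 0" "dart D g v e1 + t \<noteq> 0" "dart D g v e2 - t \<noteq> 0" "t' \<noteq> 0"
    "dart D g v e1 + t + t' \<noteq> 0" "dart D g v e2 - t - t' \<noteq> 0"
    "dart D g v e2 - t - t' + dart D g v e3 \<noteq> 0"
    using rung_values[OF A dart_nonzero(2)[OF w ev(2)] dart_nonzero(2)[OF w ev(3)] ordg] by blast
  have e3n: "e3 \<notin> {e1, e2}" using e by auto
  show ?thesis
  proof (rule add_rung[OF w v(1) ev(1,2) e(2) s(1-3) t(1-3)])
    fix D1 :: "(nat, nat) pre_digraph" and f1 g1 :: "nat \<Rightarrow> 'a" and b1 b2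
    assume D1: "witness D1 f1 g1" "card (verts D1) = card (verts D) + 2" "card (arcs D1) = card (arcs D) + 3"
      "v \<in> verts D1" "b1 \<noteq> b2" "b1 \<in> edge_cut D1 {v}" "b2 \<in> edge_cut D1 {v}"
      and val1: "dart D1 f1 v b1 = dart D f v e1 + s" "dart D1 f1 v b2 = dart D f v e2 - s"
      "dart D1 g1 v b1 = dart D g v e1 + t" "dart D1 g1 v b2 = dart D g v e2 - t"
      and third: "\<And>e3. e3 \<in> edge_cut D {v} \<Longrightarrow> e3 \<notin> {e1, e2} \<Longrightarrow> e3 \<in> edge_cut D1 {v} \<and> e3 \<notin> {b1, b2} \<and>
        dart D1 f1 v e3 = dart D f v e3 \<and> dart D1 g1 v e3 = dart D g v e3"
      and split: "\<And>e3. e3 \<in> edge_cut D {v} \<Longrightarrow> e3 \<notin> {e1, e2} \<Longrightarrow>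
        (\<And>X. X \<subseteq> verts D \<Longrightarrow> v \<notin> X \<Longrightarrow> edge_cut D X \<noteq> {e1, e2, e3}) \<Longrightarrow> splittable D1 v b2 e3"
    have sp1: "splittable D1 v b2 e3" by (rule split[OF ev(3) e3n no3])
    note third1 = third[OF ev(3) e3n]
    have no31: "edge_cut D1 X \<noteq> {b1, b2, e3}" if "X \<subseteq> verts D1" "v \<notin> X" for X
    proof
      assume eq: "edge_cut D1 X = {b1, b2, e3}"
      then have "card (edge_cut D1 X) = 3" using third1 D1(5) by auto
      then show False using sp1 that eq unfolding splittable_def by blast
    qed
    have st: "dart D1 f1 v b1 + s' \<noteq> 0" "dart D1 f1 v b2 - s' \<noteq> 0"
      "dart D1 g1 v b1 + t' \<noteq> 0" "dart D1 g1 v b2 - t' \<noteq> 0"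
      using s t unfolding val1 by blast+
    have e3n1: "e3 \<in> edge_cut D1 {v}" "e3 \<notin> {b1, b2}" using third1 by blast+
    show ?thesis
    proof (rule add_rung[OF D1(1,4,6,7,5) s(4) st(1,2) t(4) st(3,4)])
      fix D2 :: "(nat, nat) pre_digraph" and f2 g2 :: "nat \<Rightarrow> 'a" and d1 d2
      assume D2: "witness D2 f2 g2" "card (verts D2) = card (verts D1) + 2"
        "card (arcs D2) = card (arcs D1) + 3" "v \<in> verts D2" "d1 \<noteq> d2" "d1 \<in> edge_cut D2 {v}" "d2 \<in> edge_cut D2 {v}"
        and val2: "dart D2 f2 v d2 = dart D1 f1 v b2 - s'" "dart D2 g2 v d2 = dart D1 g1 v b2 - t'"
        and third': "\<And>e3. e3 \<in> edge_cut D1 {v} \<Longrightarrow> e3 \<notin> {b1, b2} \<Longrightarrow> e3 \<in> edge_cut D2 {v} \<and> e3 \<notin> {d1, d2} \<and>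
          dart D2 f2 v e3 = dart D1 f1 v e3 \<and> dart D2 g2 v e3 = dart D1 g1 v e3"
        and split': "\<And>e3. e3 \<in> edge_cut D1 {v} \<Longrightarrow> e3 \<notin> {b1, b2} \<Longrightarrow>
          (\<And>X. X \<subseteq> verts D1 \<Longrightarrow> v \<notin> X \<Longrightarrow> edge_cut D1 X \<noteq> {b1, b2, e3}) \<Longrightarrow> splittable D2 v d2 e3"
      have sp2: "splittable D2 v d2 e3" by (rule split'[OF e3n1 no31])
      note third2 = third'[OF e3n1]
      have nz: "dart D2 f2 v d2 + dart D2 f2 v e3 \<noteq> 0" "dart D2 g2 v d2 + dart D2 g2 v e3 \<noteq> 0"
        using s(7) t(7) third1 third2 unfolding val2 val1 by simp_all
      have "d2 \<noteq> e3" "e3 \<in> edge_cut D2 {v}" using third2 by blast+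
      moreover have "card (verts D2) + 1 = card (verts D) + 5" "card (arcs D2) + 1 = card (arcs D) + 7"
        using D1(2,3) D2(2,3) by simp_all
      ultimately show ?thesis
        using split_off[OF D2(1,4,7) _ _ sp2 nz] by metis
    qed
  qed
qed

lemma cubic_witness:
  fixes D :: "(nat, nat) pre_digraph" and f g :: "nat \<Rightarrow> 'a::{finite, ab_group_add}"
  assumes A: "4 \<le> card (UNIV :: 'a set)" and "witness D f g" "3 \<le> card (verts D)"
  shows "\<exists>(D' :: (nat, nat) pre_digraph) (f' :: nat \<Rightarrow> 'a) g'. witness D' f' g' \<and>
    3 \<le> card (verts D') \<and> (\<forall>v\<in>verts D'. card (edge_cut D' {v}) = 3)"
  using assms(2,3)
proof (induction "2 * card (arcs D) - 3 * card (verts D)" arbitrary: D f g rule: less_induct)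
  case less
  have D: "fin_digraph D" and nl: "\<forall>e\<in>arcs D. tail D e \<noteq> head D e"
    using less.prems(1) by (auto simp: witness_def)
  show ?case
  proof (cases "\<exists>v\<in>verts D. 4 \<le> card (edge_cut D {v})")
    case False
    have "\<forall>v\<in>verts D. card (edge_cut D {v}) = 3"
    proof
      fix v assume v: "v \<in> verts D"
      then have "\<not> 4 \<le> card (edge_cut D {v})" using False by blast
      then show "card (edge_cut D {v}) = 3"
        using witness_degree[OF less.prems v] by linarith
    qed
    then show ?thesis using less.prems by blast
  next
    case True
    then obtain v where v: "v \<in> verts D" "4 \<le> card (edge_cut D {v})" by blast
    have fin: "finite (verts D)" using D by (rule fin_digraph.finite_verts)
    have "3 * card (verts D) = (\<Sum>u\<in>verts D. 3)"
      by simp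
    also have "\<dots> < (\<Sum>u\<in>verts D. card (edge_cut D {u}))"
    proof (rule sum_strict_mono_ex1[OF fin])
      show "\<forall>u\<in>verts D. 3 \<le> card (edge_cut D {u})"
        using witness_degree[OF less.prems] by blast
      show "\<exists>u\<in>verts D. 3 < card (edge_cut D {u})"
        using v by (intro bexI[of _ v]) simp_all
    qed
    finally have "3 * card (verts D) < (\<Sum>u\<in>verts D. card (edge_cut D {u}))" .
    then have lt: "3 * card (verts D) < 2 * card (arcs D)"
      using handshake[OF D nl] by simp
    obtain D' f' g' where D': "witness (D' :: (nat, nat) pre_digraph) (f' :: nat \<Rightarrow> 'a) g'"
      "card (verts D') = card (verts D) + 5" "card (arcs D') = card (arcs D) + 7"
      using reduce_vertex[OF A less.prems(1) v] by blast
    show ?thesis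
      by (rule less.hyps[OF _ D'(1)]) (use D' lt less.prems(2) in simp_all)
  qed
qed

section \<open>Simplicity and 2-connectedness\<close>

text \<open>Two parallel edges would leave at most two edges leaving their pair of ends.\<close>

lemma simple_cubic:
  assumes D: "fin_digraph D" and nl: "\<forall>e\<in>arcs D. tail D e \<noteq> head D e" and ec: "edge_conn 3 D"
    and cub: "\<forall>v\<in>verts D. card (edge_cut D {v}) = 3" and big: "3 \<le> card (verts D)"
  shows "simple_graph (underlying D)"
proof -
  interpret fin_digraph D by fact
  have "e = e'" if e: "e \<in> arcs D" "e' \<in> arcs D" "{tail D e, head D e} = {tail D e', head D e'}" for e e'
  proof (rule ccontr)
    assume ne: "e \<noteq> e'"
    obtain u x where t: "tail D e = u" "head D e = x" by blast
    then have t': "tail D e' = u \<and> head D e' = x \<or> tail D e' = x \<and> head D e' = u"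
      using e(3) by (auto simp: doubleton_eq_iff)
    have ux: "u \<in> verts D" "x \<in> verts D" "u \<noteq> x"
      using tail_in_verts[OF e(1)] head_in_verts[OF e(1)] nl e(1) unfolding t[symmetric] by blast+
    have in_cut: "{e, e'} \<subseteq> edge_cut D {u}" "{e, e'} \<subseteq> edge_cut D {x}"
      using e(1,2) t t' ux(3) by (auto simp: edge_cut_def)
    have "i \<noteq> e \<and> i \<noteq> e'" if "i \<in> edge_cut D {u, x}" for i
      using that t t' by (auto simp: edge_cut_def)
    moreover have "i \<in> edge_cut D {u} \<union> edge_cut D {x}" if "i \<in> edge_cut D {u, x}" for i
      using that by (auto simp: edge_cut_def)
    ultimately have "edge_cut D {u, x} \<subseteq> (edge_cut D {u} - {e, e'}) \<union> (edge_cut D {x} - {e, e'})"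
      by blast
    then have "card (edge_cut D {u, x}) \<le> card ((edge_cut D {u} - {e, e'}) \<union> (edge_cut D {x} - {e, e'}))"
      by (intro card_mono) (simp_all add: finite_cut[OF D])
    also have "\<dots> \<le> card (edge_cut D {u} - {e, e'}) + card (edge_cut D {x} - {e, e'})"
      by (rule card_Un_le)
    also have "\<dots> = 2"
      using in_cut cub ux ne by (simp add: card_Diff_subset)
    finally have "\<not> 3 \<le> card (edge_cut D {u, x})" by simp
    moreover have "{u, x} \<noteq> verts D"
    proof
      assume "{u, x} = verts D"
      moreover have "card {u, x} \<le> 2" by (simp add: card_insert_if)
      ultimately show False using big by simp
    qed
    ultimately show False
      using edge_connD[OF ec, of "{u, x}"] ux by simp
  qed
  then show ?thesis
    using nl by (auto simp: simple_graph_def inj_on_def)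
qed

text \<open>
  If removing \<open>z\<close> separates \<open>X\<close> from \<open>Y\<close>, then both edge cuts consist of edges at \<open>z\<close>, which needs
  degree at least 6.
\<close>

lemma two_connected_cubic:
  assumes D: "fin_digraph D" and ec: "edge_conn 3 D"
    and cub: "\<forall>v\<in>verts D. card (edge_cut D {v}) = 3" and big: "3 \<le> card (verts D)"
  shows "k_connected 2 (underlying D)"
proof -
  interpret fin_digraph D by fact
  have conn: "conn (del_verts (underlying D) Z)" if Z: "Z \<subseteq> verts D" "card Z < 2" for Z
  proof -
    let ?G = "del_verts (underlying D) Z"
    have wf: "\<forall>e\<in>medges ?G. ends ?G e \<subseteq> mverts ?G \<and> card (ends ?G e) \<in> {1, 2}"
      by (auto simp: del_verts_def card_insert_if)
    have "card (verts D - Z) \<noteq> 0"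
      using Z big card_Diff_subset[of Z "verts D"] finite_subset[OF Z(1) finite_verts] by simp
    then have ne: "mverts ?G \<noteq> {}" by (auto simp: del_verts_def)
    have "\<exists>e\<in>medges ?G. ends ?G e \<inter> X \<noteq> {} \<and> ends ?G e - X \<noteq> {}"
      if X: "X \<subseteq> mverts ?G" "X \<noteq> {}" "X \<noteq> mverts ?G" for X
    proof (rule ccontr)
      assume no: "\<not> ?thesis"
      define Y where "Y = verts D - Z - X"
      have XY: "X \<subseteq> verts D" "Y \<subseteq> verts D" "X \<inter> Z = {}" "Y \<inter> Z = {}" "Y \<noteq> {}" "X \<inter> Y = {}"
        "X \<noteq> verts D" "Y \<noteq> verts D"
        using X by (auto simp: Y_def del_verts_def)
      have bridge: "tail D e \<in> Z \<or> head D e \<in> Z" if "e \<in> edge_cut D X \<union> edge_cut D Y" for e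
      proof (rule ccontr)
        assume "\<not> (tail D e \<in> Z \<or> head D e \<in> Z)"
        moreover from that have "e \<in> arcs D" by (auto simp: edge_cut_def)
        ultimately have "e \<in> medges ?G" by (simp add: del_verts_def)
        moreover have "(tail D e \<in> X) \<noteq> (head D e \<in> X)"
          using that \<open>e \<in> arcs D\<close> \<open>\<not> (tail D e \<in> Z \<or> head D e \<in> Z)\<close> XY
          by (auto simp: edge_cut_def Y_def)
        ultimately show False
          using no by (auto simp: del_verts_def)
      qed
      have c3: "3 \<le> card (edge_cut D X)" "3 \<le> card (edge_cut D Y)"
        using edge_connD[OF ec] X(2) XY by simp_all
      have "edge_cut D X \<noteq> {}" using c3 by auto
      then obtain e where "e \<in> edge_cut D X" by blast
      then obtain z where "z \<in> Z" using bridge by blast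
      moreover have "finite Z" using finite_subset[OF Z(1) finite_verts] .
      ultimately have "0 < card Z" using card_gt_0_iff by blast
      then have "card Z = 1" using Z(2) by linarith
      then have "Z = {z}" using \<open>z \<in> Z\<close> by (metis card_1_singletonE singletonD)
      then have "edge_cut D X \<subseteq> edge_cut D {z}" "edge_cut D Y \<subseteq> edge_cut D {z}" "edge_cut D X \<inter> edge_cut D Y = {}"
        using bridge XY by (auto simp: edge_cut_def)
      then have "card (edge_cut D X) + card (edge_cut D Y) \<le> card (edge_cut D {z})"
        using finite_cut[OF D] by (metis card_Un_disjoint card_mono Un_least)
      also have "\<dots> = 3" using cub \<open>Z = {z}\<close> Z(1) by simp
      finally show False using c3 by simp
    qed
    then show ?thesis
      using conn_iff[OF wf] ne by blast
  qed
  then show ?thesis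
    using big by (simp add: k_connected_def)
qed

lemma cubic_counterexample:
  fixes D :: "(nat, nat) pre_digraph" and f g :: "nat \<Rightarrow> 'a::ab_group_add"
  assumes w: "witness D f g" and big: "3 \<le> card (verts D)"
    and cub: "\<forall>v\<in>verts D. card (edge_cut D {v}) = 3"
  shows "\<exists>G :: (nat, nat) multigraph. fin_multigraph G \<and> simple_graph G \<and> k_connected 2 G \<and>
    k_edge_connected 3 G \<and> cubic G \<and> \<not> flow_connected TYPE('a) G"
proof (intro exI conjI)
  have D: "fin_digraph D" and nl: "\<forall>e\<in>arcs D. tail D e \<noteq> head D e" and ec: "edge_conn 3 D"
    and f: "f \<in> nz_flows D" and g: "g \<in> nz_flows D" and ns: "\<not> (flow_step D)\<^sup>*\<^sup>* f g"
    using w by (auto simp: witness_def)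
  show fin: "fin_multigraph (underlying D)" by (rule fin_underlying[OF D])
  show "simple_graph (underlying D)" by (rule simple_cubic[OF D nl ec cub big])
  show "k_connected 2 (underlying D)" by (rule two_connected_cubic[OF D ec cub big])
  show "k_edge_connected 3 (underlying D)"
    unfolding k_edge_connected_iff[OF fin orientation_underlying] using ec by (simp add: edge_conn_def)
  have "degree (underlying D) v = card (edge_cut D {v})" for v
    unfolding card_cut_vertex[OF D nl]
    using degree_tail_head[of "underlying D" "tail D" "head D" v] fin_digraph.finite_arcs[OF D] by simp
  then show "cubic (underlying D)" using cub by (simp add: regular_def)
  show "\<not> flow_connected TYPE('a) (underlying D)"
  proof
    assume "flow_connected TYPE('a) (underlying D)"
    then have "equivalent_flows (underlying D) D f g"
      using orientation_underlying f g unfolding flow_connected_def by blast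
    then show False
      using equivalent_imp_steps[OF fin orientation_underlying] ns by blast
  qed
qed

section \<open>The group of order 3\<close>

text \<open>The arc \<open>3 i + j\<close> leads from \<open>i\<close> to \<open>3 + j\<close>.\<close>

definition K33 :: "(nat, nat) pre_digraph" where
  "K33 = \<lparr>verts = {0, 1, 2, 3, 4, 5}, arcs = {0, 1, 2, 3, 4, 5, 6, 7, 8},
     tail = (\<lambda>e. e div 3), head = (\<lambda>e. 3 + e mod 3)\<rparr>"

lemma fin_K33: "fin_digraph K33"
  by unfold_locales (auto simp: K33_def)

lemma net_K33:
  "net K33 k 0 = k 0 + k 1 + k 2" "net K33 k 1 = k 3 + k 4 + k 5" "net K33 k 2 = k 6 + k 7 + k 8"
  "net K33 k 3 = - (k 0 + k 3 + k 6)" "net K33 k 4 = - (k 1 + k 4 + k 7)" "net K33 k 5 = - (k 2 + k 5 + k 8)"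
  by (simp_all add: net_def dart_def K33_def)

lemma circ_K33:
  "circ K33 k \<longleftrightarrow> k 0 + k 1 + k 2 = 0 \<and> k 3 + k 4 + k 5 = 0 \<and> k 6 + k 7 + k 8 = 0 \<and>
     k 0 + k 3 + k 6 = 0 \<and> k 1 + k 4 + k 7 = 0 \<and> k 2 + k 5 + k 8 = 0"
proof -
  have "verts K33 = {0, 1, 2, 3, 4, 5}" by (simp add: K33_def)
  then show ?thesis
    unfolding circ_def by (simp only: ball_simps net_K33 neg_equal_0_iff_equal simp_thms)
qed

lemma card_cut_K33:
  "card (edge_cut K33 X) = (\<Sum>i\<in>{0, 1, 2}. \<Sum>j\<in>{3, 4, 5}. if (i \<in> X) \<noteq> (j \<in> X) then 1 else 0)"
proof -
  have fin: "finite (arcs K33)" by (simp add: K33_def)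
  have "card (edge_cut K33 X) = (\<Sum>e\<in>edge_cut K33 X. 1)"
    by simp
  also have "\<dots> = (\<Sum>e\<in>arcs K33. if (tail K33 e \<in> X) \<noteq> (head K33 e \<in> X) then 1 else 0)"
    unfolding edge_cut_def by (rule sum.inter_filter[OF fin])
  also have "\<dots> = (\<Sum>i\<in>{0, 1, 2}. \<Sum>j\<in>{3, 4, 5}. if (i \<in> X) \<noteq> (j \<in> X) then 1 else 0)"
    by (simp add: K33_def)
  finally show ?thesis .
qed

lemma edge_conn_K33: "edge_conn 3 K33"
  unfolding edge_conn_def
proof (intro conjI allI impI)
  fix X assume X: "X \<subseteq> verts K33 \<and> X \<noteq> {} \<and> X \<noteq> verts K33"
  have V: "verts K33 = {0, 1, 2, 3, 4, 5}" by (simp add: K33_def)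
  have "0 \<in> X \<or> 1 \<in> X \<or> 2 \<in> X \<or> 3 \<in> X \<or> 4 \<in> X \<or> 5 \<in> X"
    using X unfolding V by blast
  moreover have "0 \<notin> X \<or> 1 \<notin> X \<or> 2 \<notin> X \<or> 3 \<notin> X \<or> 4 \<notin> X \<or> 5 \<notin> X"
    using X unfolding V by blast
  ultimately show "3 \<le> card (edge_cut K33 X)"
    unfolding card_cut_K33
    by (cases "0 \<in> X"; cases "1 \<in> X"; cases "2 \<in> X"; cases "3 \<in> X"; cases "4 \<in> X"; cases "5 \<in> X"; simp)
qed (simp add: K33_def)

lemma cubic_K33: "\<forall>v\<in>verts K33. card (edge_cut K33 {v}) = 3"
proof -
  have "verts K33 = {0, 1, 2, 3, 4, 5}" by (simp add: K33_def)
  then show ?thesis unfolding card_cut_K33 by simp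
qed

lemma group_of_order_three:
  assumes "card (UNIV :: ('a::{finite, ab_group_add}) set) = 3"
  obtains a :: "'a::{finite, ab_group_add}" where "a \<noteq> 0" "a \<noteq> - a" "a + a + a = 0"
    "\<And>x y z :: 'a::{finite, ab_group_add}. x \<noteq> 0 \<Longrightarrow> y \<noteq> 0 \<Longrightarrow> z \<noteq> 0 \<Longrightarrow> x + y + z = 0 \<Longrightarrow> x = y \<and> y = z"
proof -
  have "card (UNIV - {0 :: 'a}) = 2"
    using assms by (simp add: card_Diff_subset)
  then obtain a b :: 'a where ab: "UNIV - {0} = {a, b}" "a \<noteq> b"
    unfolding card_2_iff by blast
  have all: "x = a \<or> x = b" if "x \<noteq> 0" for x :: 'a
    using ab that by blast+
  have ab0: "a \<noteq> 0" "b \<noteq> 0" using ab by blast+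
  have "a + b = 0"
    using all[of "a + b"] ab0 by auto
  then have b: "b = - a" by (simp add: add_eq_0_iff)
  have na: "a \<noteq> - a" using ab(2) b by simp
  have dich: "x = a \<or> x = - a" if "x \<noteq> 0" for x using all[OF that] b by simp
  have "a + a \<noteq> 0" using na by (metis add_eq_0_iff)
  then have "a + a = - a" using dich[of "a + a"] ab0 by auto
  then have aaa: "a + a + a = 0" by simp
  have "x = y \<and> y = z" if "x \<noteq> 0" "y \<noteq> 0" "z \<noteq> 0" "x + y + z = 0" for x y z :: 'a
  proof -
    have eq: "x = y" if nz: "x \<noteq> 0" "y \<noteq> 0" "z \<noteq> 0" "x + y + z = 0" for x y z :: 'a
    proof (rule ccontr)
      assume "x \<noteq> y"
      then have "x + y = 0" using dich[OF nz(1)] dich[OF nz(2)] by auto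
      then show False using nz by simp
    qed
    have "y + z + x = 0" using that(4) by (simp add: algebra_simps)
    then show ?thesis using eq[OF that] eq[OF that(2,3,1)] by simp
  qed
  then show thesis using that[OF ab0(1) na aaa] by blast
qed

text \<open>
  Every flow is constant. A step between different constant flows would have nonzero \<open>s\<close> on every arc,
  but three values \<open>1\<close> or \<open>-1\<close> at a vertex do not sum to zero.
\<close>

lemma K33_witness:
  assumes "card (UNIV :: ('a::{finite, ab_group_add}) set) = 3"
  shows "\<exists>f g :: nat \<Rightarrow> 'a. witness K33 f g"
proof -
  obtain a :: 'a where a: "a \<noteq> 0" "a \<noteq> - a" "a + a + a = 0"
    and tri: "\<And>x y z :: 'a. x \<noteq> 0 \<Longrightarrow> y \<noteq> 0 \<Longrightarrow> z \<noteq> 0 \<Longrightarrow> x + y + z = 0 \<Longrightarrow> x = y \<and> y = z"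
    using group_of_order_three[OF assms] by metis
  let ?c = "\<lambda>x. \<lambda>e\<in>arcs K33. x :: 'a"
  note fl = nz_flows_iff[OF fin_K33]
  have "- a + - a + - a = - (a + a + a)" by simp
  then have a': "- a + - a + - a = 0" using a(3) by simp
  have c: "?c a \<in> nz_flows K33" "?c (- a) \<in> nz_flows K33"
    unfolding fl circ_restrict circ_K33 using a a' by simp_all
  have stuck: "h = ?c a" if st: "flow_step K33 (?c a) h" for h
  proof -
    obtain s b where h: "h \<in> nz_flows K33" and s: "circ K33 (s :: nat \<Rightarrow> int)"
      "\<And>e. e \<in> arcs K33 \<Longrightarrow> s e \<in> {-1, 0, 1} \<and> h e = a + signed (s e) b"
      using st unfolding flow_step_def by auto
    have nz: "h 0 \<noteq> 0" "h 1 \<noteq> 0" "h 2 \<noteq> 0" "h 3 \<noteq> 0" "h 4 \<noteq> 0" "h 5 \<noteq> 0" "h 6 \<noteq> 0" "h 7 \<noteq> 0" "h 8 \<noteq> 0"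
      and ck: "circ K33 h" and ext: "h \<in> extensional (arcs K33)"
      using h unfolding fl by (simp_all add: K33_def)
    have r: "h 1 = h 0" "h 2 = h 0" "h 3 = h 0" "h 6 = h 0" "h 4 = h 3" "h 5 = h 3" "h 7 = h 6" "h 8 = h 6"
      using ck tri[of "h 0" "h 1" "h 2"] tri[of "h 0" "h 3" "h 6"] tri[of "h 3" "h 4" "h 5"]
        tri[of "h 6" "h 7" "h 8"] nz unfolding circ_K33 by simp_all
    have "s 0 = 0 \<or> s 1 = 0 \<or> s 2 = 0"
    proof -
      have "s 0 + s 1 + s 2 = 0" using s(1) unfolding circ_K33 by blast
      moreover have "s 0 \<in> {-1, 0, 1}" "s 1 \<in> {-1, 0, 1}" "s 2 \<in> {-1, 0, 1}"
        using s(2)[of 0] s(2)[of 1] s(2)[of 2] by (simp_all add: K33_def)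
      ultimately show ?thesis by auto
    qed
    then have "h 0 = a"
      using s(2)[of 0] s(2)[of 1] s(2)[of 2] r by (auto simp: K33_def)
    then show ?thesis
      using r ext by (intro extensionalityI[of _ "arcs K33"]) (auto simp: K33_def)
  qed
  have "h = ?c a" if "(flow_step K33)\<^sup>*\<^sup>* (?c a) h" for h
    using that by (induction rule: rtranclp_induct) (use stuck in blast)+
  moreover have "?c (- a) \<noteq> ?c a"
  proof
    assume "?c (- a) = ?c a"
    then have "?c (- a) 0 = ?c a 0" by simp
    then show False using a(2) by (simp add: K33_def)
  qed
  ultimately have "\<not> (flow_step K33)\<^sup>*\<^sup>* (?c a) (?c (- a))" by blast
  moreover have "\<forall>e\<in>arcs K33. tail K33 e \<noteq> head K33 e"
    by (simp add: K33_def)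
  ultimately show ?thesis
    using c fin_K33 edge_conn_K33 unfolding witness_def by blast
qed

section \<open>From an arbitrary graph to a cubic one\<close>

theorem mainTheorem8:
  fixes H :: "('v, 'e) multigraph"
  assumes "fin_multigraph H"
    and "k_edge_connected 2 H"
    and "\<not> flow_connected TYPE('a::{finite, ab_group_add}) H"
  shows "\<exists>G :: (nat, nat) multigraph. fin_multigraph G \<and> simple_graph G \<and> k_connected 2 G \<and>
    k_edge_connected 3 G \<and> cubic G \<and> \<not> flow_connected TYPE('a) G"
proof -
  obtain D and f g :: "'e \<Rightarrow> 'a" where D: "orientation_of D H"
    and fg: "f \<in> nz_flows D" "g \<in> nz_flows D" and ne: "\<not> equivalent_flows H D f g"
    using assms(3) unfolding flow_connected_def by blast
  have fin: "fin_digraph D" by (rule orientation_fin_digraph[OF assms(1) D])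
  have ec: "edge_conn 2 D"
    using assms(2) unfolding k_edge_connected_iff[OF assms(1) D] by simp
  have ns: "\<not> (flow_step D)\<^sup>*\<^sup>* f g"
    using steps_imp_equivalent[OF assms(1) D] ne by blast
  have "f \<noteq> g" using ns by blast
  then obtain e where "e \<in> arcs D" "f e \<noteq> g e"
    using fg unfolding nz_flows_iff[OF fin] by (metis extensionalityI)
  then have "card {0, f e, g e} = 3"
    using fg unfolding nz_flows_iff[OF fin] by auto
  then have "3 \<le> card (UNIV :: 'a set)"
    using card_mono[of UNIV "{0, f e, g e}"] by simp
  then consider "card (UNIV :: 'a set) = 3" | "4 \<le> card (UNIV :: 'a set)" by linarith
  then show ?thesis
  proof cases
    case 1
    then obtain f' g' :: "nat \<Rightarrow> 'a" where "witness K33 f' g'"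
      using K33_witness by blast
    then show ?thesis
      by (rule cubic_counterexample[OF _ _ cubic_K33]) (simp add: K33_def)
  next
    case 2
    obtain D1 :: "('v, 'e) pre_digraph" and f1 g1 :: "'e \<Rightarrow> 'a" where "witness D1 f1 g1"
      using three_edge_connected_witness[OF fin ec fg ns] by blast
    then obtain D2 :: "(nat, nat) pre_digraph" and f2 g2 :: "nat \<Rightarrow> 'a" where w: "witness D2 f2 g2"
      using nat_witness by blast
    have fin2: "fin_digraph D2" and nl2: "\<forall>e\<in>arcs D2. tail D2 e \<noteq> head D2 e"
      and fg2: "f2 \<in> nz_flows D2" "g2 \<in> nz_flows D2" and ne2: "f2 \<noteq> g2"
      using w by (auto simp: witness_def)
    then obtain e where e: "e \<in> arcs D2"
      unfolding nz_flows_iff[OF fin2] by (metis extensionalityI)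
    define v where "v = tail D2 e"
    have v: "v \<in> verts D2"
      using fin_digraph.axioms(1)[OF fin2, THEN wf_digraph.tail_in_verts, OF e] by (simp add: v_def)
    have "head D2 e \<in> verts D2 - {v}"
      using fin_digraph.axioms(1)[OF fin2, THEN wf_digraph.head_in_verts, OF e] nl2 e by (auto simp: v_def)
    then have "3 \<le> card (edge_cut D2 {v})"
      using w v unfolding witness_def edge_conn_def by blast
    then have "2 \<le> card (edge_cut D2 {v})" by simp
    then obtain T where "T \<subseteq> edge_cut D2 {v}" "card T = 2"
      using obtain_subset_with_card_n by metis
    then obtain e1 e2 where e12: "e1 \<in> edge_cut D2 {v}" "e2 \<in> edge_cut D2 {v}" "e1 \<noteq> e2"
      by (auto simp: card_2_iff)
    have ex: "\<exists>t :: 'a. t \<noteq> 0 \<and> x + t \<noteq> 0 \<and> y - t \<noteq> 0" for x y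
      using avoid_three[OF 2, of 0 "- x" y] by (metis add_eq_0_iff right_minus_eq)
    obtain s where s: "s \<noteq> 0" "dart D2 f2 v e1 + s \<noteq> 0" "dart D2 f2 v e2 - s \<noteq> 0"
      using ex by blast
    obtain t where t: "t \<noteq> 0" "dart D2 g2 v e1 + t \<noteq> 0" "dart D2 g2 v e2 - t \<noteq> 0"
      using ex by blast
    obtain D3 :: "(nat, nat) pre_digraph" and f3 g3 :: "nat \<Rightarrow> 'a"
      where w3: "witness D3 f3 g3" "card (verts D3) = card (verts D2) + 2"
      by (rule add_rung[OF w v e12 s t])
    have "0 < card (verts D2)"
      using v fin_digraph.finite_verts[OF fin2] by (auto simp: card_gt_0_iff)
    then have "3 \<le> card (verts D3)" using w3(2) by simp
    then obtain D4 :: "(nat, nat) pre_digraph" and f4 g4 :: "nat \<Rightarrow> 'a" where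
      "witness D4 f4 g4" "3 \<le> card (verts D4)" "\<forall>v\<in>verts D4. card (edge_cut D4 {v}) = 3"
      using cubic_witness[OF 2 w3(1)] by blast
    then show ?thesis by (rule cubic_counterexample)
  qed
qed

end
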